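(* Assume that $g_{n,0}[\bar M]$ satisfies condition $(N_g)$ for some $\bar M\in\mathbb{R}$. Denote $N_0=[\bar M_1,\bar M_0)$ if $N_0$ is bounded from below, and $N_0=(-\infty,\bar M_0)$ otherwise. Then the two following properties are satisfied: (i) Suppose that $N_l\neq\emptyset$ for some fixed $l\in\{1,\ldots,n-1\}$ and that there is $M_1\in N_l$ such that $M_1<\bar M_0$. Then $\sup(N_l)=\sup(N_0)=\bar M_0$. Moreover, the function $\frac{\partial^l}{\partial t^l}g_{n,0}[M](t,s)$ is nonincreasing with respect to $M\in[\max\{\inf(N_0),\inf(N_l)\},\bar M_0)$ (if both infima are equal to $-\infty$ this interval is open at the left extreme). (ii) Suppose that $P_l\neq\emptyset$ for some fixed $l\in\{1,\ldots,n-1\}$ and that there is $M_1\in P_l$ such that $M_1<\bar M_0$. Then $\sup(P_l)=\sup(N_0)=\bar M_0$. Moreover, the function $\frac{\partial^l}{\partial t^l}g_{n,0}[M](t,s)$ is nondecreasing with respect to $M\in[\max\{\inf(N_0),\inf(P_l)\},\bar M_0)$ (if both infima are equal to $-\infty$ this interval is open at the left extreme).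
   Context: Let $I=[a,b]$, $M\in\mathbb{R}$. Problem $(P_{n,0}^M)$ is: find $u\in C^n(I)$ with $T_{n,0}[M]u(t)=\sigma(t)$, $t\in I$, and $B_i(u)=0$, $i=1,\ldots,n$, where $T_{n,0}[M]u(t)=u^{(n)}(t)+a_1(t)u^{(n-1)}(t)+\cdots+a_n(t)u(t)+M\,u(t)$, $B_i(u)=\sum_{j=0}^{n-1}\bigl(\alpha^i_ju^{(j)}(a)+\beta^i_ju^{(j)}(b)\bigr)$, with real constants $\alpha^i_j,\beta^i_j$ and $\sigma,a_1,\ldots,a_n\in C(I)$. "$(P_{n,0}^M)$ has a unique solution" means that it has exactly one solution for every $\sigma\in C(I)$. The Green's function of $(P_{n,0}^M)$ is $g_{n,0}[M]\in C^{n-2}(I\times I)\cap C^n((I\times I)\setminus\{(t,t):t\in I\})$ which is, for each fixed $s\in(a,b)$, the unique solution of $T_{n,0}[M](g_{n,0}[M](t,s))=0$ for $t\in I\setminus\{s\}$, $B_i(g_{n,0}[M](\cdot,s))=0$, $i=1,\ldots,n$, and which satisfies: for each $t\in(a,b)$ the following lateral limits exist, are finite, and fulfil, with $h=\frac{\partial^{n-1}}{\partial t^{n-1}}g_{n,0}[M]$, $h(t^-,t)=h(t,t^+)$, $h(t,t^-)=h(t^+,t)$ and $h(t^+,t)-h(t^-,t)=h(t,t^-)-h(t,t^+)=1$, where $h(t^{\pm},t)=\lim_{r\to t^\pm}h(r,t)$ and $h(t,t^\pm)=\lim_{r\to t^\pm}h(t,r)$. If $(P_{n,0}^M)$ has a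 unique solution, that solution is $u(t)=\int_a^b g_{n,0}[M](t,s)\sigma(s)\,ds$. Condition $(N_g)$ for $g_{n,0}[M]$: there are a continuous function $\phi$ with $\phi(t)>0$ for all $t\in(a,b)$, and $k_1,k_2\in L^1(I)$ with $k_1(s)<k_2(s)<0$ for a.e. $s\in I$, such that $\phi(t)k_1(s)\le g_{n,0}[M](t,s)\le\phi(t)k_2(s)$ for a.e. $(t,s)\in I\times I$. For $l\in\{0,\ldots,n-1\}$, $P_l=\{M\in\mathbb{R}:\frac{\partial^l}{\partial t^l}g_{n,0}[M](t,s)\ge0\ \forall(t,s)\in I\times I\}$ and $N_l=\{M\in\mathbb{R}:\frac{\partial^l}{\partial t^l}g_{n,0}[M](t,s)\le0\ \forall(t,s)\in I\times I\}$, where only values of $M$ for which $g_{n,0}[M]$ exists are considered, and derivatives of order $n-1$ are considered off the diagonal. A previously known result, used in the notation of the claim: if $(P_{n,0}^{\bar M})$ has a unique solution and $g_{n,0}[\bar M]$ satisfies $(N_g)$, and $N_0$ is bounded from below, then $N_0=[\bar M-\bar\mu,\bar M-\lambda_1)$, where $\lambda_1<0$ is the biggest negative eigenvalue of $(P_{n,0}^{\bar M})$ (i.e. the biggest $\lambda<0$ such that $T_{n,0}[\bar M]u=\lambda u$, $B_i(u)=0$, $i=1,\ldots,n$, has a nontrivial solution) and $\bar\mu\ge0$. *)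

theory Defs
  imports "HOL-Analysis.Analysis"
begin

text \<open>
  Throughout, \<open>I = [a,b]\<close>, the coefficients are \<open>c 1, \<dots>, c n\<close>, and the boundary constants are
  \<open>\<alpha> i j\<close> and \<open>\<beta> i j\<close> with \<open>1 \<le> i \<le> n\<close> and \<open>0 \<le> j < n\<close>.
\<close>

text \<open>
  All derivatives are taken within \<open>I\<close>, hence are one-sided at \<open>a\<close> and \<open>b\<close>.
\<close>

definition Dk :: "real \<Rightarrow> real \<Rightarrow> nat \<Rightarrow> (real \<Rightarrow> real) \<Rightarrow> real \<Rightarrow> real" where
  "Dk a b k u = ((\<lambda>f t. vector_derivative f (at t within {a..b})) ^^ k) u"

text \<open>
  \<open>u \<in> C\<^sup>k(J)\<close> for a relatively open subset \<open>J\<close> of \<open>I\<close> (below, \<open>J = I\<close> or \<open>J = I - {s}\<close>).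
\<close>

definition Ck_on :: "real \<Rightarrow> real \<Rightarrow> nat \<Rightarrow> real set \<Rightarrow> (real \<Rightarrow> real) \<Rightarrow> bool" where
  "Ck_on a b k J u \<longleftrightarrow>
     (\<forall>j<k. \<forall>t\<in>J. Dk a b j u differentiable (at t within {a..b})) \<and>
     (\<forall>j\<le>k. continuous_on J (Dk a b j u))"

definition T_op :: "real \<Rightarrow> real \<Rightarrow> nat \<Rightarrow> (nat \<Rightarrow> real \<Rightarrow> real) \<Rightarrow> real
    \<Rightarrow> (real \<Rightarrow> real) \<Rightarrow> real \<Rightarrow> real" where
  "T_op a b n c M u t =
     Dk a b n u t + (\<Sum>k = 1..n. c k t * Dk a b (n - k) u t) + M * u t"

definition B_op :: "real \<Rightarrow> real \<Rightarrow> nat \<Rightarrow> (nat \<Rightarrow> nat \<Rightarrow> real) \<Rightarrow> (nat \<Rightarrow> nat \<Rightarrow> real)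
    \<Rightarrow> nat \<Rightarrow> (real \<Rightarrow> real) \<Rightarrow> real" where
  "B_op a b n \<alpha> \<beta> i u = (\<Sum>j<n. \<alpha> i j * Dk a b j u a + \<beta> i j * Dk a b j u b)"

definition tderiv :: "real \<Rightarrow> real \<Rightarrow> nat \<Rightarrow> (real \<Rightarrow> real \<Rightarrow> real) \<Rightarrow> real \<Rightarrow> real \<Rightarrow> real" where
  "tderiv a b k g t s = Dk a b k (\<lambda>r. g r s) t"

definition off_diag :: "real \<Rightarrow> real \<Rightarrow> (real \<times> real) set" where
  "off_diag a b = {(t, s). t \<in> {a..b} \<and> s \<in> {a..b} \<and> t \<noteq> s}"

text \<open>
  Regularity of class \<open>C\<^sup>k\<close> of a kernel is understood as existence and joint continuity of its
  partial derivatives with respect to \<open>t\<close>.  Differentiability with respect to \<open>s\<close> is not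
  required: as the coefficients are only continuous, higher \<open>s\<close>-derivatives of the Green's function
  need not exist.
\<close>

definition Ck_kernel_on :: "real \<Rightarrow> real \<Rightarrow> nat \<Rightarrow> (real \<times> real) set
    \<Rightarrow> (real \<Rightarrow> real \<Rightarrow> real) \<Rightarrow> bool" where
  "Ck_kernel_on a b k J g \<longleftrightarrow>
     (\<forall>j<k. \<forall>(t, s)\<in>J. (\<lambda>r. tderiv a b j g r s) differentiable (at t within {a..b})) \<and>
     (\<forall>j\<le>k. continuous_on J (\<lambda>(t, s). tderiv a b j g t s))"

text \<open>
  The problem solved by \<open>v = g(\<cdot>, s)\<close> for a fixed \<open>s \<in> (a,b)\<close>; the unit jump of the derivative of
  order \<open>n - 1\<close> at \<open>s\<close> is part of it, since without it there is no uniqueness.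
\<close>

definition green_section :: "real \<Rightarrow> real \<Rightarrow> nat \<Rightarrow> (nat \<Rightarrow> real \<Rightarrow> real)
    \<Rightarrow> (nat \<Rightarrow> nat \<Rightarrow> real) \<Rightarrow> (nat \<Rightarrow> nat \<Rightarrow> real) \<Rightarrow> real \<Rightarrow> real \<Rightarrow> (real \<Rightarrow> real) \<Rightarrow> bool" where
  "green_section a b n c \<alpha> \<beta> M s v \<longleftrightarrow>
     (2 \<le> n \<longrightarrow> Ck_on a b (n - 2) {a..b} v) \<and>
     Ck_on a b n ({a..b} - {s}) v \<and>
     (\<forall>t\<in>{a..b} - {s}. T_op a b n c M v t = 0) \<and>
     (\<forall>i\<in>{1..n}. B_op a b n \<alpha> \<beta> i v = 0) \<and>
     (\<exists>p q. (Dk a b (n - 1) v \<longlongrightarrow> p) (at_left s) \<and>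
            (Dk a b (n - 1) v \<longlongrightarrow> q) (at_right s) \<and> q - p = 1)"

text \<open>
  In the last clause, with \<open>h\<close> the derivative of \<open>g\<close> of order \<open>n - 1\<close> in \<open>t\<close>,
  \<open>p = h(t\<^sup>-, t) = h(t, t\<^sup>+)\<close> and \<open>q = h(t, t\<^sup>-) = h(t\<^sup>+, t)\<close>.
\<close>

definition is_green :: "real \<Rightarrow> real \<Rightarrow> nat \<Rightarrow> (nat \<Rightarrow> real \<Rightarrow> real)
    \<Rightarrow> (nat \<Rightarrow> nat \<Rightarrow> real) \<Rightarrow> (nat \<Rightarrow> nat \<Rightarrow> real) \<Rightarrow> real \<Rightarrow> (real \<Rightarrow> real \<Rightarrow> real) \<Rightarrow> bool" where
  "is_green a b n c \<alpha> \<beta> M g \<longleftrightarrow>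
     (2 \<le> n \<longrightarrow> Ck_kernel_on a b (n - 2) ({a..b} \<times> {a..b}) g) \<and>
     Ck_kernel_on a b n (off_diag a b) g \<and>
     (\<forall>s\<in>{a<..<b}. green_section a b n c \<alpha> \<beta> M s (\<lambda>t. g t s) \<and>
        (\<forall>v. green_section a b n c \<alpha> \<beta> M s v \<longrightarrow> (\<forall>t\<in>{a..b} - {s}. v t = g t s))) \<and>
     (\<forall>t\<in>{a<..<b}. \<exists>p q.
        ((\<lambda>r. tderiv a b (n - 1) g r t) \<longlongrightarrow> p) (at_left t) \<and>
        ((\<lambda>r. tderiv a b (n - 1) g t r) \<longlongrightarrow> p) (at_right t) \<and>
        ((\<lambda>r. tderiv a b (n - 1) g t r) \<longlongrightarrow> q) (at_left t) \<and>
        ((\<lambda>r. tderiv a b (n - 1) g r t) \<longlongrightarrow> q) (at_right t) \<and>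
        q - p = 1)"

definition has_green :: "real \<Rightarrow> real \<Rightarrow> nat \<Rightarrow> (nat \<Rightarrow> real \<Rightarrow> real)
    \<Rightarrow> (nat \<Rightarrow> nat \<Rightarrow> real) \<Rightarrow> (nat \<Rightarrow> nat \<Rightarrow> real) \<Rightarrow> real \<Rightarrow> bool" where
  "has_green a b n c \<alpha> \<beta> M \<longleftrightarrow> (\<exists>g. is_green a b n c \<alpha> \<beta> M g)"

text \<open>
  For \<open>n \<ge> 2\<close>, \<open>is_green\<close> determines the kernel on \<open>I \<times> I\<close>, and only its values there matter below.
\<close>

definition green :: "real \<Rightarrow> real \<Rightarrow> nat \<Rightarrow> (nat \<Rightarrow> real \<Rightarrow> real)
    \<Rightarrow> (nat \<Rightarrow> nat \<Rightarrow> real) \<Rightarrow> (nat \<Rightarrow> nat \<Rightarrow> real) \<Rightarrow> real \<Rightarrow> real \<Rightarrow> real \<Rightarrow> real" where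
  "green a b n c \<alpha> \<beta> M = (SOME g. is_green a b n c \<alpha> \<beta> M g)"

definition cond_Ng :: "real \<Rightarrow> real \<Rightarrow> (real \<Rightarrow> real \<Rightarrow> real) \<Rightarrow> bool" where
  "cond_Ng a b g \<longleftrightarrow> (\<exists>\<phi> k1 k2.
     continuous_on {a..b} \<phi> \<and> (\<forall>t\<in>{a<..<b}. \<phi> t > 0) \<and>
     k1 absolutely_integrable_on {a..b} \<and> k2 absolutely_integrable_on {a..b} \<and>
     (AE s in lebesgue_on {a..b}. k1 s < k2 s \<and> k2 s < 0) \<and>
     (AE (t, s) in lebesgue_on ({a..b} \<times> {a..b}).
        \<phi> t * k1 s \<le> g t s \<and> g t s \<le> \<phi> t * k2 s))"

definition green_dom :: "real \<Rightarrow> real \<Rightarrow> nat \<Rightarrow> nat \<Rightarrow> (real \<times> real) set" where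
  "green_dom a b n l = (if l = n - 1 then off_diag a b else {a..b} \<times> {a..b})"

definition P_set :: "real \<Rightarrow> real \<Rightarrow> nat \<Rightarrow> (nat \<Rightarrow> real \<Rightarrow> real)
    \<Rightarrow> (nat \<Rightarrow> nat \<Rightarrow> real) \<Rightarrow> (nat \<Rightarrow> nat \<Rightarrow> real) \<Rightarrow> nat \<Rightarrow> real set" where
  "P_set a b n c \<alpha> \<beta> l = {M. has_green a b n c \<alpha> \<beta> M \<and>
     (\<forall>(t, s)\<in>green_dom a b n l. tderiv a b l (green a b n c \<alpha> \<beta> M) t s \<ge> 0)}"

definition N_set :: "real \<Rightarrow> real \<Rightarrow> nat \<Rightarrow> (nat \<Rightarrow> real \<Rightarrow> real)
    \<Rightarrow> (nat \<Rightarrow> nat \<Rightarrow> real) \<Rightarrow> (nat \<Rightarrow> nat \<Rightarrow> real) \<Rightarrow> nat \<Rightarrow> real set" where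
  "N_set a b n c \<alpha> \<beta> l = {M. has_green a b n c \<alpha> \<beta> M \<and>
     (\<forall>(t, s)\<in>green_dom a b n l. tderiv a b l (green a b n c \<alpha> \<beta> M) t s \<le> 0)}"

text \<open>
  The interval \<open>[max {inf X, inf Y}, m)\<close>.  The infima are extended reals, so that the left end is
  automatically open when both are \<open>-\<infinity>\<close>.
\<close>

definition max_inf_interval :: "real set \<Rightarrow> real set \<Rightarrow> real \<Rightarrow> real set" where
  "max_inf_interval X Y m =
     {M. max (Inf (ereal ` X)) (Inf (ereal ` Y)) \<le> ereal M \<and> M < m}"

end

theory Submission
  imports Defs
begin

text \<open>
  Convolution with the kernel \<open>g[M]\<close> solves the boundary value problem for every continuous right-hand
  side, so uniqueness yields the resolvent identity
  \<open>\<partial>\<^sup>l g[M'] - \<partial>\<^sup>l g[M] = (M - M') \<integral> \<partial>\<^sup>l g[M](t, r) g[M'](r, s) dr\<close>, which is used in operator form.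
  For \<open>M \<le> M'\<close>, \<open>\<partial>\<^sup>l g[M] \<le> 0\<close> and \<open>g[M'] \<le> 0\<close> it shows that \<open>\<partial>\<^sup>l g\<close> decreases, which settles
  monotonicity.  That no \<open>M\<close> above \<open>N\<^sub>0\<close> belongs to \<open>N\<^sub>l\<close> needs no spectral theory: with
  \<open>F = |\<partial>\<^sup>l g[M]|\<close>, \<open>E = |\<partial>\<^sup>l g[M'']|\<close>, \<open>A = |g[M'']|\<close> and \<open>M'' < M\<close> in \<open>N\<^sub>0 \<inter> N\<^sub>l\<close>, the identity
  \<open>F = E + (M - M'') F A\<close> makes \<open>F\<close> a positive supersolution, and a maximum principle gives
  \<open>g[M] \<le> 0\<close>, that is, \<open>M \<in> N\<^sub>0\<close>.  Replacing \<open>\<partial>\<^sup>l g\<close> by its negative gives the result for \<open>P\<^sub>l\<close>.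
\<close>

text \<open>The coefficients are only continuous, so there is no adjoint equation in s: regularity
  of the kernel in s is plain continuity, sections are constrained only for s in the open interval,
  and order n - 1 is controlled only off the diagonal. Testing against continuous functions hides
  these exceptions, and pointwise signs are recovered from continuity in s. A nonpositive kernel may
  have zeros, while the maximum principle needs strictness twice. For the derivative of order l the
  unit jump provides it: a kernel with a jump cannot vanish identically. For g itself it comes from
  (N_g), which is known at \<open>Mbar\<close> alone and is carried upward by monotonicity; hence
  M'' has to lie above \<open>Mbar\<close> and is chosen as the maximum of \<open>Mbar\<close> and
  the given M1. The interval of monotonicity is closed on the left, whereas the infimum of N_l is
  not attained a priori. It is reached by letting M' decrease to it in the resolvent identity, with
  a bound uniform in M' that again comes from monotonicity on N_0.\<close>

section \<open>Iterated derivatives within I and one-sided mean value estimates\<close>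

lemma Dk_0 [simp]: "Dk a b 0 u = u"
  by (simp add: Dk_def)

lemma Dk_Suc: "Dk a b (Suc k) u t = vector_derivative (Dk a b k u) (at t within {a..b})"
  by (simp add: Dk_def)

lemma has_vector_derivative_transform_openin:
  assumes "openin (top_of_set S) J" "t \<in> J" "\<And>x. x \<in> J \<Longrightarrow> f x = g x"
    and "(f has_vector_derivative d) (at t within S)"
  shows "(g has_vector_derivative d) (at t within S)"
proof -
  obtain e where e: "e > 0" "\<forall>x\<in>S. dist x t < e \<longrightarrow> x \<in> J" and "J \<subseteq> S"
    using assms(1,2) unfolding openin_euclidean_subtopology_iff by blast
  then show ?thesis
    using has_vector_derivative_transform_within[OF assms(4) e(1), of g] assms(2,3) by blast
qed

lemma openin_Icc_minus: "openin (top_of_set {a..b}) ({a..b} - {s :: real})"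
  by (metis Diff_eq open_delete open_UNIV openin_open_Int Compl_eq_Diff_UNIV)

text \<open>\<open>Dk\<close> iterates a chosen derivative, so each order can be computed only after
  the previous one is known near the point. A chain \<open>U\<close> with \<open>U (Suc j)\<close>
  the derivative of \<open>U j\<close> settles all orders in one induction. Relative openness of
  \<open>J\<close> makes the derivative within I depend on values in \<open>J\<close> only, and
  \<open>a < b\<close> makes it unique at the end points as well.\<close>

lemma Dk_chain:
  assumes ab: "a < b" and J: "openin (top_of_set {a..b}) J"
    and u: "\<And>t. t \<in> J \<Longrightarrow> u t = U 0 t"
    and U: "\<And>j t. j < m \<Longrightarrow> t \<in> J \<Longrightarrow>
      (U j has_vector_derivative U (Suc j) t) (at t within {a..b})"
  shows "j \<le> m \<Longrightarrow> t \<in> J \<Longrightarrow> Dk a b j u t = U j t"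
    and "j < m \<Longrightarrow> t \<in> J \<Longrightarrow>
      (Dk a b j u has_vector_derivative U (Suc j) t) (at t within {a..b})"
proof -
  have JI: "J \<subseteq> {a..b}"
    using J openin_imp_subset by blast
  have step: "(Dk a b j u has_vector_derivative U (Suc j) t) (at t within {a..b})"
    if "j < m" "t \<in> J" "\<And>t. t \<in> J \<Longrightarrow> Dk a b j u t = U j t" for j t
    using has_vector_derivative_transform_openin[OF J that(2) _ U[OF that(1,2)]] that(3) by simp
  have eq: "j \<le> m \<Longrightarrow> t \<in> J \<Longrightarrow> Dk a b j u t = U j t" for j t
  proof (induction j arbitrary: t)
    case (Suc j)
    then show ?case
      using step[of j t] JI ab vector_derivative_within_cbox[of a b t "Dk a b j u" "U (Suc j) t"]
      by (auto simp: Dk_Suc)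
  qed (use u in auto)
  show "j \<le> m \<Longrightarrow> t \<in> J \<Longrightarrow> Dk a b j u t = U j t"
    by (rule eq)
  show "j < m \<Longrightarrow> t \<in> J \<Longrightarrow>
      (Dk a b j u has_vector_derivative U (Suc j) t) (at t within {a..b})"
    using step eq by simp
qed

lemma Ck_on_chainI:
  assumes "a < b" "openin (top_of_set {a..b}) J"
    and "\<And>t. t \<in> J \<Longrightarrow> u t = U 0 t"
    and "\<And>j t. j < m \<Longrightarrow> t \<in> J \<Longrightarrow>
      (U j has_vector_derivative U (Suc j) t) (at t within {a..b})"
    and "\<And>j. j \<le> m \<Longrightarrow> continuous_on J (U j)"
  shows "Ck_on a b m J u"
proof -
  have "Dk a b j u differentiable at t within {a..b}" if "j < m" "t \<in> J" for j t
    using Dk_chain(2)[OF assms(1-4) that] by (metis differentiableI_vector)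
  moreover have "continuous_on J (Dk a b j u)" if "j \<le> m" for j
    using assms(5)[OF that] Dk_chain(1)[OF assms(1-4) that]
    by (subst continuous_on_cong[OF refl, of _ _ "U j"]) auto
  ultimately show ?thesis
    by (simp add: Ck_on_def)
qed

lemma Ck_on_deriv:
  assumes "Ck_on a b m J u" "j < m" "t \<in> J"
  shows "(Dk a b j u has_vector_derivative Dk a b (Suc j) u t) (at t within {a..b})"
  using assms by (auto simp: Ck_on_def Dk_Suc vector_derivative_works[symmetric])

lemma Ck_on_cont: "Ck_on a b m J u \<Longrightarrow> j \<le> m \<Longrightarrow> continuous_on J (Dk a b j u)"
  by (simp add: Ck_on_def)

lemma
  assumes "a < b" "openin (top_of_set {a..b}) J" "Ck_on a b m J u" "Ck_on a b m J v"
  shows Ck_on_lincomb: "Ck_on a b m J (\<lambda>t. p * u t + q * v t)"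
    and Dk_lincomb: "j \<le> m \<Longrightarrow> t \<in> J \<Longrightarrow>
      Dk a b j (\<lambda>t. p * u t + q * v t) t = p * Dk a b j u t + q * Dk a b j v t"
proof -
  let ?U = "\<lambda>j t. p * Dk a b j u t + q * Dk a b j v t"
  have d: "(?U j has_vector_derivative ?U (Suc j) t) (at t within {a..b})"
    if "j < m" "t \<in> J" for j t
    using Ck_on_deriv[OF assms(3) that] Ck_on_deriv[OF assms(4) that]
    by (auto intro!: derivative_eq_intros
        simp: has_real_derivative_iff_has_vector_derivative[symmetric])
  show "Ck_on a b m J (\<lambda>t. p * u t + q * v t)"
    by (rule Ck_on_chainI[where U = ?U])
      (use assms d in \<open>auto intro!: continuous_intros Ck_on_cont\<close>)
  show "j \<le> m \<Longrightarrow> t \<in> J \<Longrightarrow>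
      Dk a b j (\<lambda>t. p * u t + q * v t) t = p * Dk a b j u t + q * Dk a b j v t"
    using Dk_chain(1)[where U = ?U, OF assms(1,2) _ d] by simp
qed

lemma T_op_lincomb:
  assumes "a < b" "openin (top_of_set {a..b}) J" "Ck_on a b n J u" "Ck_on a b n J v" "t \<in> J"
  shows "T_op a b n c M (\<lambda>t. p * u t + q * v t) t = p * T_op a b n c M u t + q * T_op a b n c M v t"
proof -
  have "(\<Sum>k = 1..n. c k t * Dk a b (n - k) (\<lambda>t. p * u t + q * v t) t) =
      (\<Sum>k = 1..n. p * (c k t * Dk a b (n - k) u t) + q * (c k t * Dk a b (n - k) v t))"
    by (rule sum.cong) (auto simp: Dk_lincomb[OF assms(1-4) _ assms(5)] algebra_simps)
  then show ?thesis
    by (simp add: T_op_def Dk_lincomb[OF assms(1-4) _ assms(5)] sum.distrib sum_distrib_left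
        algebra_simps)
qed

lemma Dk_cong:
  assumes "a < b" "openin (top_of_set {a..b}) J" "Ck_on a b m J v"
    and "\<And>t. t \<in> J \<Longrightarrow> u t = v t" "j \<le> m" "t \<in> J"
  shows "Dk a b j u t = Dk a b j v t"
  by (rule Dk_chain(1)[where U = "\<lambda>j. Dk a b j v", OF assms(1,2)])
    (use assms Ck_on_deriv[OF assms(3)] in auto)

text \<open>On either side of \<open>s\<close> this is the mean value theorem. Points on opposite
  sides are compared through the common one-sided limit \<open>p\<close>, so the value at
  \<open>s\<close> and differentiability there do not enter. It is applied to kernel sections that
  are continuous at the diagonal or have had their jump removed.\<close>

lemma real_lipschitz_off_point:
  fixes f f' :: "real \<Rightarrow> real"
  assumes d: "\<And>x. x \<in> {a..b} - {s} \<Longrightarrow> (f has_vector_derivative f' x) (at x within {a..b})"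
    and L: "\<And>x. x \<in> {a..b} - {s} \<Longrightarrow> \<bar>f' x\<bar> \<le> L"
    and lim: "(f \<longlongrightarrow> p) (at_left s)" "(f \<longlongrightarrow> p) (at_right s)"
    and "x \<in> {a..b} - {s}" "y \<in> {a..b} - {s}"
  shows "\<bar>f x - f y\<bar> \<le> L * \<bar>x - y\<bar>"
proof -
  have side: "\<bar>f x - f y\<bar> \<le> L * \<bar>x - y\<bar>" if "{x..y} \<subseteq> {a..b} - {s}" "x \<le> y" for x y
  proof -
    have "(f has_field_derivative f' z) (at z within {x..y})" if z: "z \<in> {x..y}" for z
      using has_vector_derivative_within_subset[OF d, of z "{x..y}"] \<open>{x..y} \<subseteq> _\<close> z
      unfolding has_real_derivative_iff_has_vector_derivative by blast
    then show ?thesis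
      using field_differentiable_bound[of "{x..y}" f f' L x y] that L subsetD[OF that(1)]
      by auto
  qed
  have left: "\<bar>f x - p\<bar> \<le> L * \<bar>x - s\<bar>" if "a \<le> x" "x < s" "s \<le> b" for x
  proof (rule tendsto_le[of "at_left s"])
    show "eventually (\<lambda>z. \<bar>f x - f z\<bar> \<le> L * \<bar>x - z\<bar>) (at_left s)"
      using eventually_at_left_real[OF \<open>x < s\<close>]
      by eventually_elim (use that in \<open>intro side, auto\<close>)
  qed (use lim in \<open>auto intro!: tendsto_intros\<close>)
  have right: "\<bar>p - f y\<bar> \<le> L * \<bar>s - y\<bar>" if "s < y" "y \<le> b" "a \<le> s" for y
  proof (rule tendsto_le[of "at_right s"])
    show "eventually (\<lambda>z. \<bar>f z - f y\<bar> \<le> L * \<bar>z - y\<bar>) (at_right s)"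
      using eventually_at_right_real[OF \<open>s < y\<close>]
      by eventually_elim (use that in \<open>intro side, auto\<close>)
  qed (use lim in \<open>auto intro!: tendsto_intros\<close>)
  have main: "\<bar>f x - f y\<bar> \<le> L * \<bar>x - y\<bar>" if "x \<le> y" "x \<in> {a..b} - {s}" "y \<in> {a..b} - {s}" for x y
  proof (cases "x < s \<and> s < y")
    case True
    then have "\<bar>f x - p\<bar> \<le> L * \<bar>x - s\<bar>" "\<bar>p - f y\<bar> \<le> L * \<bar>s - y\<bar>"
      using left right that by auto
    moreover have "L * \<bar>x - y\<bar> = L * \<bar>x - s\<bar> + L * \<bar>s - y\<bar>"
      using True by (simp add: algebra_simps)
    ultimately show ?thesis
      by linarith
  qed (use that in \<open>intro side, auto\<close>)
  show ?thesis
    using main[of x y] main[of y x] assms(5,6) by (cases "x \<le> y") (auto simp: abs_minus_commute)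
qed

section \<open>Integration over the open interval\<close>

text \<open>The end points are left out because sections of the Green's function are constrained for
  s in the open interval only; facts about sections then hold at every point of the space.\<close>

definition Lam :: "real \<Rightarrow> real \<Rightarrow> real measure" where
  "Lam a b = restrict_space lborel {a<..<b}"

lemma space_Lam [simp]: "space (Lam a b) = {a<..<b}"
  by (simp add: Lam_def space_restrict_space)

lemma finite_measure_Lam: "finite_measure (Lam a b)"
proof
  show "emeasure (Lam a b) (space (Lam a b)) \<noteq> \<infinity>"
    using emeasure_lborel_box_finite[of a b]
    by (simp add: Lam_def emeasure_restrict_space space_restrict_space)
qed

lemma AE_Lam_neq: "countable X \<Longrightarrow> AE r in Lam a b. r \<notin> X"
  unfolding Lam_def
  by (subst AE_restrict_space_iff)
    (auto intro!: eventually_mono[OF AE_not_in[OF countable_imp_null_set_lborel]])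

lemma borel_measurable_Lam:
  fixes f :: "real \<Rightarrow> real"
  assumes "continuous_on ({a<..<b} - {t}) f"
  shows "f \<in> borel_measurable (Lam a b)"
proof -
  have 1: "f \<in> borel_measurable (restrict_space (Lam a b) {r. r \<noteq> t})"
  proof -
    have "f \<in> borel_measurable (restrict_space borel ({a<..<b} - {t}))"
      by (rule borel_measurable_continuous_on_restrict[OF assms])
    moreover have "sets (restrict_space (Lam a b) {r. r \<noteq> t}) =
        sets (restrict_space borel ({a<..<b} - {t}))"
    proof -
      have "{a<..<b} \<inter> {r. r \<noteq> t} = {a<..<b} - {t}"
        by auto
      then show ?thesis
        unfolding Lam_def sets_restrict_restrict_space
        by (simp add: sets_restrict_space)
    qed
    ultimately show ?thesis
      by (simp cong: measurable_cong_sets)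
  qed
  have "(\<lambda>r. if r \<noteq> t then f r else f t) \<in> borel_measurable (Lam a b)"
  proof (subst measurable_If_restrict_space_iff)
    have "{a<..<b} - {t} \<in> sets (Lam a b)"
      by (auto simp: Lam_def sets_restrict_space_iff)
    then show "{x \<in> space (Lam a b). x \<noteq> t} \<in> sets (Lam a b)"
      by (simp add: set_diff_eq)
  qed (use 1 in auto)
  then show ?thesis
    by (rule measurable_cong[THEN iffD1, rotated]) auto
qed

lemma integrable_Lam:
  fixes f :: "real \<Rightarrow> real"
  assumes "continuous_on ({a<..<b} - {t}) f"
    and "\<And>r. r \<in> {a<..<b} - {t} \<Longrightarrow> \<bar>f r\<bar> \<le> C"
  shows "integrable (Lam a b) f"
proof (rule finite_measure.integrable_const_bound[OF finite_measure_Lam])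
  show "AE r in Lam a b. norm (f r) \<le> C"
    using AE_Lam_neq[of "{t}" a b, simplified] AE_space by eventually_elim (use assms in auto)
qed (rule borel_measurable_Lam[OF assms(1)])

text \<open>Dominated convergence, with \<open>L * B\<close> dominating the difference quotients.
  The Lipschitz bound and the derivative are available off the diagonal only. A sequence
  \<open>X\<close> meets the diagonal for countably many \<open>r\<close>, a null set, which is why
  the limit is taken along sequences.\<close>

lemma has_vector_derivative_integral_Lam:
  fixes K K' :: "real \<Rightarrow> real \<Rightarrow> real"
  assumes t: "t \<in> {a..b}"
    and lip: "\<And>r x y. r \<in> {a<..<b} \<Longrightarrow> x \<in> {a..b} - {r} \<Longrightarrow> y \<in> {a..b} - {r} \<Longrightarrow>
      \<bar>K x r - K y r\<bar> \<le> L * \<bar>x - y\<bar>"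
    and int: "\<And>x. x \<in> {a..b} \<Longrightarrow> integrable (Lam a b) (\<lambda>r. K x r * \<sigma> r)"
    and meas: "(\<lambda>r. K' t r * \<sigma> r) \<in> borel_measurable (Lam a b)"
    and d: "\<And>r. r \<in> {a<..<b} - {t} \<Longrightarrow>
      ((\<lambda>x. K x r) has_vector_derivative K' t r) (at t within {a..b})"
    and \<sigma>: "\<And>r. r \<in> {a<..<b} \<Longrightarrow> \<bar>\<sigma> r\<bar> \<le> B"
  shows "((\<lambda>x. \<integral>r. K x r * \<sigma> r \<partial>Lam a b) has_vector_derivative (\<integral>r. K' t r * \<sigma> r \<partial>Lam a b))
    (at t within {a..b})"
  unfolding has_real_derivative_iff_has_vector_derivative[symmetric] has_field_derivative_iff
    tendsto_at_iff_sequentially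
proof (intro allI impI)
  fix X :: "nat \<Rightarrow> real"
  assume X: "\<forall>i. X i \<in> {a..b} - {t}" "X \<longlonglongrightarrow> t"
  let ?q = "\<lambda>i r. (K (X i) r * \<sigma> r - K t r * \<sigma> r) / (X i - t)"
  have ae: "AE r in Lam a b. r \<notin> insert t (range X) \<and> r \<in> {a<..<b}"
    using AE_Lam_neq[OF countable_insert[OF countable_image[OF countableI_type]], of t X UNIV a b]
      AE_space
    by eventually_elim auto
  have "(\<lambda>i. \<integral>r. ?q i r \<partial>Lam a b) \<longlonglongrightarrow> (\<integral>r. K' t r * \<sigma> r \<partial>Lam a b)"
  proof (rule integral_dominated_convergence[where w = "\<lambda>_. L * B"])
    show "?q i \<in> borel_measurable (Lam a b)" for i
      using int[of "X i"] int[OF t] X by (auto dest!: borel_measurable_integrable)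
    show "integrable (Lam a b) (\<lambda>_. L * B)"
      using finite_measure.integrable_const[OF finite_measure_Lam] by blast
    show "AE r in Lam a b. (\<lambda>i. ?q i r) \<longlonglongrightarrow> K' t r * \<sigma> r"
      using ae
    proof eventually_elim
      case (elim r)
      have "((\<lambda>x. (K x r - K t r) / (x - t)) \<longlongrightarrow> K' t r) (at t within {a..b})"
        using d[of r] elim
        by (auto simp: has_real_derivative_iff_has_vector_derivative[symmetric] has_field_derivative_iff)
      then have "(\<lambda>i. (K (X i) r - K t r) / (X i - t)) \<longlonglongrightarrow> K' t r"
        using X unfolding tendsto_at_iff_sequentially comp_def by blast
      then have "(\<lambda>i. (K (X i) r - K t r) / (X i - t) * \<sigma> r) \<longlonglongrightarrow> K' t r * \<sigma> r"
        by (intro tendsto_intros)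
      then show ?case
        by (simp add: left_diff_distrib)
    qed
    show "AE r in Lam a b. norm (?q i r) \<le> L * B" for i
      using ae
    proof eventually_elim
      case (elim r)
      have Xt: "\<bar>X i - t\<bar> > 0"
        using X(1) by auto
      have "\<bar>K (X i) r - K t r\<bar> \<le> L * \<bar>X i - t\<bar>"
        using X(1) t elim by (intro lip) auto
      then have "\<bar>K (X i) r - K t r\<bar> / \<bar>X i - t\<bar> \<le> L"
        using Xt by (simp add: divide_le_eq)
      moreover have "\<bar>\<sigma> r\<bar> \<le> B"
        using \<sigma> elim by auto
      ultimately have "\<bar>K (X i) r - K t r\<bar> / \<bar>X i - t\<bar> * \<bar>\<sigma> r\<bar> \<le> L * B"
        by (intro mult_mono) (auto intro: order_trans[rotated])
      then show ?case
        by (simp add: left_diff_distrib[symmetric] abs_mult)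
    qed
  qed (rule meas)
  moreover have "(\<integral>r. ?q i r \<partial>Lam a b) =
      ((\<integral>r. K (X i) r * \<sigma> r \<partial>Lam a b) - (\<integral>r. K t r * \<sigma> r \<partial>Lam a b)) / (X i - t)" for i
    using Bochner_Integration.integral_diff[OF int[of "X i"] int[OF t]] X(1)
    by (subst integral_divide_zero) auto
  ultimately show "((\<lambda>x. ((\<integral>r. K x r * \<sigma> r \<partial>Lam a b) - (\<integral>r. K t r * \<sigma> r \<partial>Lam a b)) / (x - t)) \<circ> X)
      \<longlonglongrightarrow> (\<integral>r. K' t r * \<sigma> r \<partial>Lam a b)"
    by (simp only: comp_def)
qed

text \<open>Evaluates the step function that is split off from the derivative of order n - 1; as a
  primitive of \<sigma> it produces the extra term when differentiated.\<close>

lemma integral_Lam_lessThan: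
  fixes \<sigma> :: "real \<Rightarrow> real"
  assumes "continuous_on {a..b} \<sigma>" "t \<in> {a..b}"
  shows "(\<integral>r. (if r < t then 1 else 0) * \<sigma> r \<partial>Lam a b) = integral {a..t} \<sigma>"
proof -
  have "(\<integral>r. (if r < t then 1 else 0) * \<sigma> r \<partial>Lam a b) =
      (LINT r:{a<..<t}|lborel. \<sigma> r)"
    unfolding Lam_def set_lebesgue_integral_def
    by (subst integral_restrict_space)
      (use assms(2) in \<open>auto intro!: Bochner_Integration.integral_cong simp: indicator_def\<close>)
  also have "\<dots> = integral {a<..<t} \<sigma>"
  proof (rule set_borel_integral_eq_integral)
    have "set_integrable lborel {a..t} \<sigma>"
      by (rule borel_integrable_atLeastAtMost')
        (use assms in \<open>auto intro: continuous_on_subset\<close>)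
    then show "set_integrable lborel {a<..<t} \<sigma>"
      by (rule set_integrable_subset) auto
  qed
  also have "\<dots> = integral {a..t} \<sigma>"
    by (rule integral_open_interval_real[symmetric])
  finally show ?thesis .
qed

lemma integral_Lam_pos:
  fixes f :: "real \<Rightarrow> real"
  assumes f: "integrable (Lam a b) f" and nn: "AE r in Lam a b. 0 \<le> f r"
    and xy: "x < y" "a \<le> x" "y \<le> b" and e: "e > 0" "\<And>r. r \<in> {x<..<y} \<Longrightarrow> e \<le> f r"
  shows "(\<integral>r. f r \<partial>Lam a b) > 0"
proof -
  have "0 < e * measure (Lam a b) {x<..<y}"
    using xy e(1) by (simp add: Lam_def measure_restrict_space greaterThanLessThan_subseteq_greaterThanLessThan)
  also have "\<dots> = (\<integral>r. e * indicator {x<..<y} r \<partial>Lam a b)"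
    using xy by (auto simp: Lam_def space_restrict_space intro!: arg_cong[where f = "measure _"])
  also have "\<dots> \<le> (\<integral>r. f r \<partial>Lam a b)"
  proof (rule integral_mono_AE)
    have "{x<..<y} \<in> sets (Lam a b)"
      using xy by (auto simp: Lam_def sets_restrict_space_iff)
    then show "integrable (Lam a b) (\<lambda>r. e * indicator {x<..<y} r)"
      by (intro integrable_mult_right integrable_real_indicator)
        (auto simp: finite_measure.emeasure_finite[OF finite_measure_Lam] less_top[symmetric])
    show "AE r in Lam a b. e * indicator {x<..<y} r \<le> f r"
      using nn by eventually_elim (use e in \<open>auto simp: indicator_def\<close>)
  qed (rule f)
  finally show ?thesis .
qed

section \<open>Integral operators of the kernel and the boundary value problem\<close>

text \<open>The derivative stays inside the integral. For \<open>k < n\<close> the result is the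
  derivative of order \<open>k\<close> of \<open>green_op a b g 0 \<sigma>\<close>, but at
  \<open>k = n\<close> it falls short of it by \<sigma>, since the pointwise kernel does not see the
  jump.\<close>

definition green_op :: "real \<Rightarrow> real \<Rightarrow> (real \<Rightarrow> real \<Rightarrow> real) \<Rightarrow> nat \<Rightarrow> (real \<Rightarrow> real) \<Rightarrow> real \<Rightarrow> real"
  where "green_op a b g k \<sigma> t = (\<integral>r. tderiv a b k g t r * \<sigma> r \<partial>Lam a b)"

definition bvp_solution :: "real \<Rightarrow> real \<Rightarrow> nat \<Rightarrow> (nat \<Rightarrow> real \<Rightarrow> real)
    \<Rightarrow> (nat \<Rightarrow> nat \<Rightarrow> real) \<Rightarrow> (nat \<Rightarrow> nat \<Rightarrow> real) \<Rightarrow> real \<Rightarrow> (real \<Rightarrow> real) \<Rightarrow> (real \<Rightarrow> real) \<Rightarrow> bool"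
  where "bvp_solution a b n c \<alpha> \<beta> M \<sigma> u \<longleftrightarrow>
    Ck_on a b n {a..b} u \<and> (\<forall>t\<in>{a..b}. T_op a b n c M u t = \<sigma> t) \<and>
    (\<forall>i\<in>{1..n}. B_op a b n \<alpha> \<beta> i u = 0)"

lemma continuous_on_bounded_real:
  fixes f :: "'a::topological_space \<Rightarrow> real"
  assumes "compact S" "continuous_on S f"
  obtains C where "C \<ge> 0" "\<And>x. x \<in> S \<Longrightarrow> \<bar>f x\<bar> \<le> C"
proof -
  have "bounded (f ` S)"
    using assms compact_continuous_image compact_imp_bounded by blast
  then obtain C where "C > 0" "\<forall>y\<in>f ` S. norm y \<le> C"
    using bounded_pos by blast
  then show ?thesis
    using that[of C] by auto
qed

lemma openin_Icc: "openin (top_of_set {a..b}) {a..b :: real}"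
  by simp

text \<open>The premise concerns the two end points only, so that it also applies to sections, which
  are of class C^n only away from an interior point.\<close>

lemma B_op_lincomb:
  assumes "\<And>j t. j < n \<Longrightarrow> t \<in> {a, b} \<Longrightarrow> Dk a b j w t = p * Dk a b j u t + q * Dk a b j v t"
  shows "B_op a b n \<alpha> \<beta> i w = p * B_op a b n \<alpha> \<beta> i u + q * B_op a b n \<alpha> \<beta> i v"
  unfolding B_op_def sum_distrib_left sum.distrib[symmetric]
  by (rule sum.cong) (use assms in \<open>auto simp: algebra_simps\<close>)

section \<open>One Green's function: continuity, jump and uniform bounds\<close>

locale green_function =
  fixes a b :: real and n :: nat and c :: "nat \<Rightarrow> real \<Rightarrow> real"
    and \<alpha> \<beta> :: "nat \<Rightarrow> nat \<Rightarrow> real" and M :: real and g :: "real \<Rightarrow> real \<Rightarrow> real"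
  assumes ab: "a < b" and n2: "2 \<le> n"
    and coeffs: "\<And>k. k \<in> {1..n} \<Longrightarrow> continuous_on {a..b} (c k)"
    and green: "is_green a b n c \<alpha> \<beta> M g"
begin

abbreviation K :: "nat \<Rightarrow> real \<Rightarrow> real \<Rightarrow> real" where "K k \<equiv> tderiv a b k g"

lemma K_eq: "K k t s = Dk a b k (\<lambda>r. g r s) t"
  by (simp add: tderiv_def)

lemma continuous_on_K_square:
  "k \<le> n - 2 \<Longrightarrow> continuous_on ({a..b} \<times> {a..b}) (\<lambda>(t, s). K k t s)"
  using green n2 by (auto simp: is_green_def Ck_kernel_on_def)

lemma continuous_on_K_off_diag:
  "k \<le> n \<Longrightarrow> continuous_on (off_diag a b) (\<lambda>(t, s). K k t s)"
  using green by (auto simp: is_green_def Ck_kernel_on_def)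

lemma K_deriv:
  assumes "k < n" "t \<in> {a..b}" "s \<in> {a..b}" "t \<noteq> s"
  shows "((\<lambda>r. K k r s) has_vector_derivative K (Suc k) t s) (at t within {a..b})"
  using green assms unfolding is_green_def Ck_kernel_on_def off_diag_def
  by (auto simp: tderiv_def Dk_Suc vector_derivative_works[symmetric])

lemma green_sectionD:
  assumes "s \<in> {a<..<b}"
  shows "green_section a b n c \<alpha> \<beta> M s (\<lambda>t. g t s)"
    and "green_section a b n c \<alpha> \<beta> M s v \<Longrightarrow> t \<in> {a..b} - {s} \<Longrightarrow> v t = g t s"
  using green assms by (auto simp: is_green_def)

lemma K_ode:
  assumes "s \<in> {a<..<b}" "t \<in> {a..b} - {s}"
  shows "K n t s = - (\<Sum>k = 1..n. c k t * K (n - k) t s) - M * K 0 t s"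
proof -
  have "T_op a b n c M (\<lambda>t. g t s) t = 0"
    using green_sectionD(1)[OF assms(1)] assms(2) by (simp add: green_section_def)
  then show ?thesis
    by (simp add: T_op_def K_eq)
qed

lemma K_jump:
  assumes "s \<in> {a<..<b}"
  obtains p where "((\<lambda>t. K (n - 1) t s) \<longlongrightarrow> p) (at_left s)"
    "((\<lambda>t. K (n - 1) t s) \<longlongrightarrow> p + 1) (at_right s)"
proof -
  obtain p q where "(Dk a b (n - 1) (\<lambda>t. g t s) \<longlongrightarrow> p) (at_left s)"
    "(Dk a b (n - 1) (\<lambda>t. g t s) \<longlongrightarrow> q) (at_right s)" "q - p = 1"
    using green_sectionD(1)[OF assms] by (auto simp: green_section_def)
  moreover from this have "q = p + 1"
    by simp
  ultimately show ?thesis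
    using that by (simp add: K_eq)
qed

lemma continuous_on_K_slice:
  assumes "k \<le> n" "t \<in> {a..b}"
  shows "continuous_on ({a..b} - {t}) (\<lambda>r. K k t r)"
  by (rule continuous_on_compose2[OF continuous_on_K_off_diag[OF assms(1)], of _ "Pair t", simplified])
    (use assms(2) in \<open>auto intro!: continuous_intros simp: off_diag_def\<close>)

lemma eventually_at_side:
  assumes "s \<in> {a<..<b}"
  shows "\<forall>\<^sub>F t in at_left s. t \<in> {a<..<s}" "\<forall>\<^sub>F t in at_right s. t \<in> {s<..<b}"
  using assms eventually_at_left_real[of a s] eventually_at_right_real[of s b] by auto

text \<open>
  Near the diagonal the derivative of order \<open>n - 1\<close> is controlled by the equation: multiplied by
  the integrating factor and with the jump removed, it is Lipschitz in \<open>t\<close>, uniformly in \<open>s\<close>; and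
  every section has an end point at a distance from the diagonal.
\<close>

lemma K_bounded:
  obtains C where "C \<ge> 0"
    "\<And>k s t. k \<le> n \<Longrightarrow> s \<in> {a<..<b} \<Longrightarrow> t \<in> {a..b} - {s} \<Longrightarrow> \<bar>K k t s\<bar> \<le> C"
proof -
  let ?bd = "\<lambda>k C. \<forall>s\<in>{a<..<b}. \<forall>t\<in>{a..b} - {s}. \<bar>K k t s\<bar> \<le> C"
  have low: "\<exists>C. ?bd k C" if k: "k \<le> n - 2" for k
  proof -
    obtain C where "C \<ge> 0" "\<And>x. x \<in> {a..b} \<times> {a..b} \<Longrightarrow> \<bar>(\<lambda>(t, s). K k t s) x\<bar> \<le> C"
      using continuous_on_bounded_real[OF _ continuous_on_K_square[OF k]] compact_Times compact_Icc
      by blast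
    then show ?thesis
      by (intro exI[of _ C]) force
  qed
  have term_bd: "\<exists>R\<ge>0. \<forall>s\<in>{a<..<b}. \<forall>t\<in>{a..b} - {s}. \<bar>c k t * K (n - k) t s\<bar> \<le> R"
    if k: "k \<in> {1..n}" and bd: "?bd (n - k) C" for k C
  proof -
    obtain D where D: "D \<ge> 0" "\<And>t. t \<in> {a..b} \<Longrightarrow> \<bar>c k t\<bar> \<le> D"
      using continuous_on_bounded_real[OF compact_Icc coeffs[OF k]] by blast
    show ?thesis
    proof (intro exI[of _ "D * \<bar>C\<bar>"] conjI ballI)
      fix s t assume s: "s \<in> {a<..<b}" and t: "t \<in> {a..b} - {s}"
      then have "\<bar>K (n - k) t s\<bar> \<le> \<bar>C\<bar>"
        using bd by force
      then show "\<bar>c k t * K (n - k) t s\<bar> \<le> D * \<bar>C\<bar>"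
        unfolding abs_mult by (intro mult_mono D) (use t D(1) in auto)
    qed (use D in simp)
  qed
  have sum_bd: "\<exists>R\<ge>0. \<forall>s\<in>{a<..<b}. \<forall>t\<in>{a..b} - {s}.
      \<bar>(\<Sum>k\<in>A. c k t * K (n - k) t s) + M * K 0 t s\<bar> \<le> R"
    if A: "A \<subseteq> {1..n}" and bd: "\<And>k. k \<in> A \<Longrightarrow> \<exists>C. ?bd (n - k) C" for A
  proof -
    have "\<forall>k\<in>A. \<exists>R\<ge>0. \<forall>s\<in>{a<..<b}. \<forall>t\<in>{a..b} - {s}. \<bar>c k t * K (n - k) t s\<bar> \<le> R"
      using term_bd bd A by (meson subsetD)
    then obtain R where R: "\<And>k. k \<in> A \<Longrightarrow> R k \<ge> 0"
      "\<And>k s t. k \<in> A \<Longrightarrow> s \<in> {a<..<b} \<Longrightarrow> t \<in> {a..b} - {s} \<Longrightarrow> \<bar>c k t * K (n - k) t s\<bar> \<le> R k"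
      by metis
    obtain C where C: "?bd 0 C"
      using low[of 0] by auto
    show ?thesis
    proof (intro exI[of _ "sum R A + \<bar>M\<bar> * \<bar>C\<bar>"] conjI ballI)
      show "0 \<le> sum R A + \<bar>M\<bar> * \<bar>C\<bar>"
        using R(1) by (simp add: sum_nonneg)
      fix s t assume st: "s \<in> {a<..<b}" "t \<in> {a..b} - {s}"
      have "\<bar>\<Sum>k\<in>A. c k t * K (n - k) t s\<bar> \<le> sum R A"
        by (rule sum_abs[THEN order_trans]) (intro sum_mono R st)
      moreover have "\<bar>M * K 0 t s\<bar> \<le> \<bar>M\<bar> * \<bar>C\<bar>"
        unfolding abs_mult using C st by (intro mult_left_mono) force+
      ultimately show "\<bar>(\<Sum>k\<in>A. c k t * K (n - k) t s) + M * K 0 t s\<bar> \<le> sum R A + \<bar>M\<bar> * \<bar>C\<bar>"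
        by linarith
    qed
  qed

  define p where "p t = exp (integral {a..t} (c 1))" for t
  have c1: "continuous_on {a..b} (c 1)"
    using coeffs[of 1] n2 by simp
  have p_deriv: "(p has_vector_derivative p t * c 1 t) (at t within {a..b})" if "t \<in> {a..b}" for t
    using integral_has_vector_derivative[OF c1 that]
    unfolding p_def has_real_derivative_iff_has_vector_derivative[symmetric]
    by (auto intro!: derivative_eq_intros)
  have p_cont: "continuous_on {a..b} p"
    using p_deriv has_vector_derivative_continuous
    unfolding continuous_on_eq_continuous_within by blast
  have p_pos: "p t > 0" for t
    by (simp add: p_def)
  obtain P where P: "P \<ge> 0" "\<And>t. t \<in> {a..b} \<Longrightarrow> p t \<le> P"
    by (rule continuous_on_bounded_real[OF compact_Icc p_cont]) (blast intro: abs_le_D1)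
  have p_inv: "continuous_on {a..b} (\<lambda>t. 1 / p t)"
    using p_pos by (intro continuous_intros p_cont) (auto simp: less_imp_neq[symmetric])
  obtain P' where P': "P' \<ge> 0" "\<And>t. t \<in> {a..b} \<Longrightarrow> 1 / p t \<le> P'"
    by (rule continuous_on_bounded_real[OF compact_Icc p_inv]) (blast intro: abs_le_D1)

  \<comment> \<open>The term k = 1 is the one of order n - 1 and is absorbed by the integrating
    factor \<open>p\<close>. The indices in \<open>A\<close> involve orders at most n - 2, which are
    bounded by compactness of the square.\<close>
  define A where "A = {2..n}"
  have one_A: "{1..n} = insert 1 A" "1 \<notin> A"
    using n2 by (auto simp: A_def)
  obtain R where R: "R \<ge> 0" "\<And>s t. s \<in> {a<..<b} \<Longrightarrow> t \<in> {a..b} - {s} \<Longrightarrow>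
      \<bar>(\<Sum>k\<in>A. c k t * K (n - k) t s) + M * K 0 t s\<bar> \<le> R"
  proof -
    have "\<exists>R\<ge>0. \<forall>s\<in>{a<..<b}. \<forall>t\<in>{a..b} - {s}.
        \<bar>(\<Sum>k\<in>A. c k t * K (n - k) t s) + M * K 0 t s\<bar> \<le> R"
      by (rule sum_bd) (auto simp: A_def intro!: low)
    then show ?thesis
      using that by blast
  qed
  \<comment> \<open>The unit jump of \<open>K (n - 1)\<close> at \<open>s\<close> becomes a jump
    \<open>p s\<close> after multiplication by \<open>p\<close>; subtracting it beyond
    \<open>s\<close> equalises the two lateral limits.\<close>
  define f where "f s t = p t * K (n - 1) t s - (if s < t then p s else 0)" for s t
  have f_lip: "\<bar>f s x - f s y\<bar> \<le> P * R * \<bar>x - y\<bar>"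
    if s: "s \<in> {a<..<b}" and xy: "x \<in> {a..b} - {s}" "y \<in> {a..b} - {s}" for s x y
  proof -
    obtain q where q: "((\<lambda>t. K (n - 1) t s) \<longlongrightarrow> q) (at_left s)"
      "((\<lambda>t. K (n - 1) t s) \<longlongrightarrow> q + 1) (at_right s)"
      using K_jump[OF s] .
    have p_lim: "(p \<longlongrightarrow> p s) (at_left s)" "(p \<longlongrightarrow> p s) (at_right s)"
    proof -
      have "isCont p s"
        using p_cont s by (auto intro: continuous_on_interior)
      then show "(p \<longlongrightarrow> p s) (at_left s)" "(p \<longlongrightarrow> p s) (at_right s)"
        by (auto simp: isCont_def filterlim_at_split)
    qed
    have 1: "(f s \<longlongrightarrow> p s * q) (at_left s)"
    proof (rule Lim_transform_eventually)
      show "((\<lambda>t. p t * K (n - 1) t s) \<longlongrightarrow> p s * q) (at_left s)"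
        by (intro tendsto_intros q p_lim)
      show "\<forall>\<^sub>F t in at_left s. p t * K (n - 1) t s = f s t"
        using eventually_at_side(1)[OF s] by eventually_elim (auto simp: f_def)
    qed
    have 2: "(f s \<longlongrightarrow> p s * q) (at_right s)"
    proof (rule Lim_transform_eventually)
      have "((\<lambda>t. p t * K (n - 1) t s - p s) \<longlongrightarrow> p s * (q + 1) - p s) (at_right s)"
        by (intro tendsto_intros q p_lim)
      then show "((\<lambda>t. p t * K (n - 1) t s - p s) \<longlongrightarrow> p s * q) (at_right s)"
        by (simp add: algebra_simps)
      show "\<forall>\<^sub>F t in at_right s. p t * K (n - 1) t s - p s = f s t"
        using eventually_at_side(2)[OF s] by eventually_elim (auto simp: f_def)
    qed
    show ?thesis
    proof (rule real_lipschitz_off_point[OF _ _ 1 2 xy])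
      fix t assume t: "t \<in> {a..b} - {s}"
      let ?d = "- (p t * ((\<Sum>k\<in>A. c k t * K (n - k) t s) + M * K 0 t s))"
      have "K n t s + c 1 t * K (n - 1) t s = - ((\<Sum>k\<in>A. c k t * K (n - k) t s) + M * K 0 t s)"
        using K_ode[OF s t] one_A by (simp add: A_def)
      then have d: "?d = p t * (K n t s + c 1 t * K (n - 1) t s)"
        by (simp only: mult_minus_right)
      have "((\<lambda>t. p t * K (n - 1) t s) has_vector_derivative ?d) (at t within {a..b})"
        using p_deriv[of t] K_deriv[of "n - 1" t s] n2 s t
        unfolding d has_real_derivative_iff_has_vector_derivative[symmetric]
        by (auto intro!: derivative_eq_intros simp: algebra_simps)
      then have "((\<lambda>x. p x * K (n - 1) x s - (if s < t then p s else 0))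
          has_vector_derivative ?d) (at t within {a..b})"
        by (simp add: has_vector_derivative_diff_const)
      moreover have "\<forall>x\<in>{a..b}. dist x t < dist s t \<longrightarrow>
          p x * K (n - 1) x s - (if s < t then p s else 0) = f s x"
        by (auto simp: f_def dist_real_def)
      ultimately show "(f s has_vector_derivative ?d) (at t within {a..b})"
        using has_vector_derivative_transform_within[of _ ?d t "{a..b}" "dist s t" "f s"] t
        by auto
      show "\<bar>?d\<bar> \<le> P * R"
        using R(2)[OF s t] P(2)[of t] p_pos[of t] t P(1)
        by (auto simp: abs_mult intro!: mult_mono)
    qed
  qed
  \<comment> \<open>For \<open>s\<close> up to the midpoint the end point \<open>b\<close> stays
    away from the diagonal, for the other \<open>s\<close> the end point \<open>a\<close> does. On
    each half the slice at that end point is continuous on a compact interval, hence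
    bounded.\<close>
  define m where "m = (a + b) / 2"
  have m: "a < m" "m < b"
    using ab by (auto simp: m_def)
  obtain Ca where Ca: "Ca \<ge> 0" "\<And>s. s \<in> {m..b} \<Longrightarrow> \<bar>K (n - 1) a s\<bar> \<le> Ca"
  proof -
    have "continuous_on {m..b} (K (n - 1) a)"
      by (rule continuous_on_subset[OF continuous_on_K_slice]) (use m in auto)
    then show ?thesis
      by (rule continuous_on_bounded_real[OF compact_Icc]) (rule that)
  qed
  obtain Cb where Cb: "Cb \<ge> 0" "\<And>s. s \<in> {a..m} \<Longrightarrow> \<bar>K (n - 1) b s\<bar> \<le> Cb"
  proof -
    have "continuous_on {a..m} (K (n - 1) b)"
      by (rule continuous_on_subset[OF continuous_on_K_slice]) (use m in auto)
    then show ?thesis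
      by (rule continuous_on_bounded_real[OF compact_Icc]) (rule that)
  qed
  have f_le: "\<bar>f s x\<bar> \<le> P * \<bar>K (n - 1) x s\<bar> + P" if "s \<in> {a<..<b}" "x \<in> {a..b}" for s x
  proof -
    have "\<bar>p x * K (n - 1) x s\<bar> \<le> P * \<bar>K (n - 1) x s\<bar>"
      unfolding abs_mult using P(2)[of x] p_pos[of x] that by (intro mult_right_mono) auto
    moreover have "\<bar>if s < x then p s else 0\<bar> \<le> P"
      using P(1) P(2)[of s] p_pos[of s] that by auto
    ultimately show ?thesis
      unfolding f_def by linarith
  qed
  \<comment> \<open>The bound of \<open>f\<close> at the far end point plus the Lipschitz constant
    times the length of I.\<close>
  define F where "F = P * (Ca + Cb) + P + P * R * (b - a)"
  have F: "\<bar>f s t\<bar> \<le> F" if s: "s \<in> {a<..<b}" and t: "t \<in> {a..b} - {s}" for s t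
  proof -
    obtain x where x: "x \<in> {a..b} - {s}" "\<bar>K (n - 1) x s\<bar> \<le> Ca + Cb"
    proof (cases "s \<le> m")
      case True
      then show ?thesis
        using that[of b] Cb(2)[of s] Ca(1) s ab by force
    next
      case False
      then show ?thesis
        using that[of a] Ca(2)[of s] Cb(1) s ab by force
    qed
    have "\<bar>f s x\<bar> \<le> P * (Ca + Cb) + P"
      using f_le[OF s, of x] x mult_left_mono[OF x(2) P(1)] by auto
    moreover have "\<bar>f s t - f s x\<bar> \<le> P * R * (b - a)"
      by (rule order_trans[OF f_lip[OF s t x(1)] mult_left_mono]) (use t x(1) P(1) R(1) in auto)
    ultimately show ?thesis
      unfolding F_def by linarith
  qed
  have high: "?bd (n - 1) (P' * (F + P))"
  proof (intro ballI)
    fix s t assume s: "s \<in> {a<..<b}" and t: "t \<in> {a..b} - {s}"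
    have "p t * \<bar>K (n - 1) t s\<bar> = \<bar>f s t + (if s < t then p s else 0)\<bar>"
      using p_pos[of t] by (simp add: f_def abs_mult)
    also have "\<dots> \<le> F + P"
      using F[OF s t] P(1) P(2)[of s] p_pos[of s] s by (auto simp: abs_le_iff)
    finally have "\<bar>K (n - 1) t s\<bar> \<le> 1 / p t * (F + P)"
      using p_pos[of t] by (simp add: field_simps)
    also have "\<dots> \<le> P' * (F + P)"
      using P'(2)[of t] t F[OF s t] P(1) by (intro mult_right_mono) auto
    finally show "\<bar>K (n - 1) t s\<bar> \<le> P' * (F + P)" .
  qed
  have bd1: "\<exists>C. ?bd k C" if "k < n" for k
  proof (cases "k = n - 1")
    case True
    with high show ?thesis
      by blast
  next
    case False
    with that show ?thesis
      by (intro low) linarith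
  qed
  then obtain R' where R': "\<And>s t. s \<in> {a<..<b} \<Longrightarrow> t \<in> {a..b} - {s} \<Longrightarrow>
      \<bar>(\<Sum>k = 1..n. c k t * K (n - k) t s) + M * K 0 t s\<bar> \<le> R'"
  proof -
    have "\<exists>R\<ge>0. \<forall>s\<in>{a<..<b}. \<forall>t\<in>{a..b} - {s}.
        \<bar>(\<Sum>k = 1..n. c k t * K (n - k) t s) + M * K 0 t s\<bar> \<le> R"
      by (rule sum_bd) (use n2 in \<open>auto intro!: bd1\<close>)
    then show ?thesis
      using that by blast
  qed
  have "?bd n R'"
  proof (intro ballI)
    fix s t assume s: "s \<in> {a<..<b}" and t: "t \<in> {a..b} - {s}"
    show "\<bar>K n t s\<bar> \<le> R'"
      unfolding K_ode[OF s t] using R'[OF s t] by linarith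
  qed
  then have "\<exists>C. ?bd k C" if "k \<in> {..n}" for k
    using bd1[of k] that by (cases "k = n") auto
  then have "\<forall>k\<in>{..n}. \<exists>C. ?bd k C"
    by (rule ballI)
  then obtain C where C: "\<forall>k\<in>{..n}. ?bd k (C k)"
    unfolding bchoice_iff by (elim exE)
  show ?thesis
  proof (rule that[of "\<Sum>k\<le>n. \<bar>C k\<bar>"])
    fix k s t assume k: "k \<le> n" and st: "s \<in> {a<..<b}" "t \<in> {a..b} - {s}"
    have "\<bar>K k t s\<bar> \<le> \<bar>C k\<bar>"
      using C[rule_format, of k s t] k st by auto
    also have "\<dots> \<le> (\<Sum>k\<le>n. \<bar>C k\<bar>)"
      using k by (intro member_le_sum) auto
    finally show "\<bar>K k t s\<bar> \<le> (\<Sum>k\<le>n. \<bar>C k\<bar>)" .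
  qed (simp add: sum_nonneg)
qed

end

section \<open>The integral operator solves the problem, and the solution is unique\<close>

context green_function
begin

abbreviation S :: "nat \<Rightarrow> (real \<Rightarrow> real) \<Rightarrow> real \<Rightarrow> real" where "S \<equiv> green_op a b g"

lemma integrable_K:
  assumes "k \<le> n" "t \<in> {a..b}" "continuous_on {a..b} \<sigma>"
  shows "integrable (Lam a b) (\<lambda>r. K k t r * \<sigma> r)"
proof -
  obtain C where C: "C \<ge> 0" "\<And>k s t. k \<le> n \<Longrightarrow> s \<in> {a<..<b} \<Longrightarrow> t \<in> {a..b} - {s} \<Longrightarrow> \<bar>K k t s\<bar> \<le> C"
    using K_bounded by blast
  obtain B where B: "B \<ge> 0" "\<And>r. r \<in> {a..b} \<Longrightarrow> \<bar>\<sigma> r\<bar> \<le> B"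
    using continuous_on_bounded_real[OF compact_Icc assms(3)] by blast
  show ?thesis
  proof (rule integrable_Lam)
    show "continuous_on ({a<..<b} - {t}) (\<lambda>r. K k t r * \<sigma> r)"
      by (intro continuous_intros continuous_on_subset[OF continuous_on_K_slice[OF assms(1,2)]]
          continuous_on_subset[OF assms(3)]) auto
    show "\<bar>K k t r * \<sigma> r\<bar> \<le> C * B" if "r \<in> {a<..<b} - {t}" for r
      unfolding abs_mult using that assms(2) C(1) by (intro mult_mono C(2)[OF assms(1)] B(2)) auto
  qed
qed

text \<open>The constant does not depend on \<sigma>, which keeps the error term of the resolvent
  identity under control when the parameter tends to a limit.\<close>

lemma green_op_bound:
  obtains C where "C \<ge> 0"
    "\<And>k (\<sigma> :: real \<Rightarrow> real) B t. k \<le> n \<Longrightarrow> t \<in> {a..b} \<Longrightarrow> continuous_on {a..b} \<sigma> \<Longrightarrow>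
      (\<And>r. r \<in> {a..b} \<Longrightarrow> \<bar>\<sigma> r\<bar> \<le> B) \<Longrightarrow> \<bar>S k \<sigma> t\<bar> \<le> C * B"
proof -
  obtain C where C: "C \<ge> 0" "\<And>k s t. k \<le> n \<Longrightarrow> s \<in> {a<..<b} \<Longrightarrow> t \<in> {a..b} - {s} \<Longrightarrow> \<bar>K k t s\<bar> \<le> C"
    using K_bounded by blast
  show ?thesis
  proof (rule that[of "C * measure (Lam a b) (space (Lam a b))"])
    fix k and t B :: real and \<sigma> :: "real \<Rightarrow> real"
    assume *: "k \<le> n" "t \<in> {a..b}" "continuous_on {a..b} \<sigma>" "\<And>r. r \<in> {a..b} \<Longrightarrow> \<bar>\<sigma> r\<bar> \<le> B"
    have "\<bar>S k \<sigma> t\<bar> \<le> (\<integral>r. \<bar>K k t r * \<sigma> r\<bar> \<partial>Lam a b)"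
      unfolding green_op_def by (rule integral_abs_bound)
    also have "\<dots> \<le> (\<integral>r. C * B \<partial>Lam a b)"
    proof (rule integral_mono_AE)
      show "integrable (Lam a b) (\<lambda>r. C * B)"
        using finite_measure.integrable_const[OF finite_measure_Lam] by blast
      show "integrable (Lam a b) (\<lambda>r. \<bar>K k t r * \<sigma> r\<bar>)"
        using integrable_K[OF *(1-3)] by simp
      show "AE r in Lam a b. \<bar>K k t r * \<sigma> r\<bar> \<le> C * B"
        using AE_Lam_neq[of "{t}" a b, simplified] AE_space
      proof eventually_elim
        case (elim r)
        then show ?case
          unfolding abs_mult using *(1,2) C(1) by (intro mult_mono C(2) *(4)) auto
      qed
    qed
    finally show "\<bar>S k \<sigma> t\<bar> \<le> C * measure (Lam a b) (space (Lam a b)) * B"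
      by (simp add: algebra_simps)
  qed (use C in simp)
qed

lemma green_op_lincomb:
  assumes "k \<le> n" "t \<in> {a..b}" "continuous_on {a..b} \<sigma>" "continuous_on {a..b} \<tau>"
  shows "S k (\<lambda>r. p * \<sigma> r + q * \<tau> r) t = p * S k \<sigma> t + q * S k \<tau> t"
proof -
  have "S k (\<lambda>r. p * \<sigma> r + q * \<tau> r) t =
      (\<integral>r. p * (K k t r * \<sigma> r) + q * (K k t r * \<tau> r) \<partial>Lam a b)"
    by (simp add: green_op_def algebra_simps)
  also have "\<dots> = p * S k \<sigma> t + q * S k \<tau> t"
    using integrable_K[OF assms(1-3)] integrable_K[OF assms(1,2,4)] by (simp add: green_op_def)
  finally show ?thesis .
qed

lemma green_op_top:
  assumes "t \<in> {a..b}" "continuous_on {a..b} \<sigma>"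
  shows "S n \<sigma> t = - (\<Sum>k = 1..n. c k t * S (n - k) \<sigma> t) - M * S 0 \<sigma> t"
proof -
  have "S n \<sigma> t = (\<integral>r. - (\<Sum>k = 1..n. c k t * (K (n - k) t r * \<sigma> r)) - M * (K 0 t r * \<sigma> r) \<partial>Lam a b)"
    unfolding green_op_def
  proof (rule integral_cong_AE)
    show "AE r in Lam a b. K n t r * \<sigma> r =
        - (\<Sum>k = 1..n. c k t * (K (n - k) t r * \<sigma> r)) - M * (K 0 t r * \<sigma> r)"
      using AE_Lam_neq[of "{t}" a b, simplified] AE_space
      by eventually_elim
        (use assms(1) in \<open>auto simp: K_ode sum_distrib_right sum_distrib_left algebra_simps\<close>)
    have m: "(\<lambda>r. K k t r * \<sigma> r) \<in> borel_measurable (Lam a b)" if "k \<le> n" for k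
      by (rule borel_measurable_integrable[OF integrable_K[OF that assms]])
    show "(\<lambda>r. K n t r * \<sigma> r) \<in> borel_measurable (Lam a b)"
      by (rule m) simp
    show "(\<lambda>r. - (\<Sum>k = 1..n. c k t * (K (n - k) t r * \<sigma> r)) - M * (K 0 t r * \<sigma> r))
        \<in> borel_measurable (Lam a b)"
      by (intro m borel_measurable_diff borel_measurable_uminus borel_measurable_sum
          borel_measurable_times borel_measurable_const) auto
  qed
  also have "\<dots> = - (\<Sum>k = 1..n. c k t * S (n - k) \<sigma> t) - M * S 0 \<sigma> t"
    using integrable_K[OF _ assms] by (simp add: green_op_def)
  finally show ?thesis .
qed

text \<open>An order below n - 1 is continuous across the diagonal, so its sections are Lipschitz
  with the bound of the next order as constant, and differentiation under the integral
  applies.\<close>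

lemma green_op_deriv:
  assumes k: "k < n - 1" and t: "t \<in> {a..b}" and \<sigma>: "continuous_on {a..b} \<sigma>"
  shows "(S k \<sigma> has_vector_derivative S (Suc k) \<sigma> t) (at t within {a..b})"
proof -
  obtain C where C: "C \<ge> 0" "\<And>k s t. k \<le> n \<Longrightarrow> s \<in> {a<..<b} \<Longrightarrow> t \<in> {a..b} - {s} \<Longrightarrow> \<bar>K k t s\<bar> \<le> C"
    using K_bounded by blast
  obtain B where B: "B \<ge> 0" "\<And>r. r \<in> {a..b} \<Longrightarrow> \<bar>\<sigma> r\<bar> \<le> B"
    using continuous_on_bounded_real[OF compact_Icc \<sigma>] by blast
  show ?thesis
    unfolding green_op_def
  proof (rule has_vector_derivative_integral_Lam[OF t, where L = C and B = B])
    fix r x y assume r: "r \<in> {a<..<b}" and xy: "x \<in> {a..b} - {r}" "y \<in> {a..b} - {r}"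
    have "continuous_on {a..b} (\<lambda>t. K k t r)"
      by (rule continuous_on_compose2[OF continuous_on_K_square, of _ _ "\<lambda>t. (t, r)", simplified])
        (use k r in \<open>auto intro!: continuous_intros\<close>)
    then have "isCont (\<lambda>t. K k t r) r"
      using r by (auto intro: continuous_on_interior)
    then have lim: "((\<lambda>t. K k t r) \<longlongrightarrow> K k r r) (at_left r)" "((\<lambda>t. K k t r) \<longlongrightarrow> K k r r) (at_right r)"
      by (auto simp: isCont_def filterlim_at_split)
    show "\<bar>K k x r - K k y r\<bar> \<le> C * \<bar>x - y\<bar>"
      by (rule real_lipschitz_off_point[OF K_deriv _ lim xy]) (use k r C in auto)
  next
    show "integrable (Lam a b) (\<lambda>r. K k x r * \<sigma> r)" if "x \<in> {a..b}" for x
      using k that by (intro integrable_K \<sigma>) auto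
    show "(\<lambda>r. K (Suc k) t r * \<sigma> r) \<in> borel_measurable (Lam a b)"
      using k by (intro borel_measurable_integrable integrable_K t \<sigma>) auto
    show "((\<lambda>x. K k x r) has_vector_derivative K (Suc k) t r) (at t within {a..b})"
      if "r \<in> {a<..<b} - {t}" for r
      using that t k by (intro K_deriv) auto
    show "\<bar>\<sigma> r\<bar> \<le> B" if "r \<in> {a<..<b}" for r
      using that by (intro B) auto
  qed
qed

text \<open>The jump of the kernel across the diagonal contributes the term \<open>\<sigma> t\<close>.\<close>

lemma green_op_deriv_top:
  assumes t: "t \<in> {a..b}" and \<sigma>: "continuous_on {a..b} \<sigma>"
  shows "(S (n - 1) \<sigma> has_vector_derivative S n \<sigma> t + \<sigma> t) (at t within {a..b})"
proof -
  obtain C where C: "C \<ge> 0" "\<And>k s t. k \<le> n \<Longrightarrow> s \<in> {a<..<b} \<Longrightarrow> t \<in> {a..b} - {s} \<Longrightarrow> \<bar>K k t s\<bar> \<le> C"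
    using K_bounded by blast
  obtain B where B: "B \<ge> 0" "\<And>r. r \<in> {a..b} \<Longrightarrow> \<bar>\<sigma> r\<bar> \<le> B"
    using continuous_on_bounded_real[OF compact_Icc \<sigma>] by blast
  \<comment> \<open>\<open>H\<close> carries exactly the unit jump of \<open>K (n - 1)\<close>. The
    difference \<open>L\<close> has equal lateral limits at the diagonal and can be differentiated
    under the integral; the part with \<open>H\<close> is the primitive of \<sigma>.\<close>
  define H where "H t r = (if r < t then 1 else 0 :: real)" for t r :: real
  define L where "L t r = K (n - 1) t r - H t r" for t r
  have H_int: "integrable (Lam a b) (\<lambda>r. H x r * \<sigma> r)" for x
  proof (rule integrable_Lam)
    have "continuous_on ({a<..<b} - {x}) (H x)"
    proof (rule continuous_at_imp_continuous_on, rule ballI)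
      fix r assume "r \<in> {a<..<b} - {x}"
      then have "r < x \<or> x < r"
        by auto
      then have "\<forall>\<^sub>F y in nhds r. H x r = H x y"
      proof
        assume "r < x"
        then show ?thesis
          using order_tendstoD(2)[OF filterlim_ident, of r x]
          by (auto simp: H_def elim: eventually_mono)
      next
        assume "x < r"
        then show ?thesis
          using order_tendstoD(1)[OF filterlim_ident, of x r]
          by (auto simp: H_def elim: eventually_mono)
      qed
      then show "isCont (H x) r"
        by (subst isCont_cong[of _ "\<lambda>_. H x r"]) (auto elim: eventually_mono)
    qed
    then show "continuous_on ({a<..<b} - {x}) (\<lambda>r. H x r * \<sigma> r)"
      by (intro continuous_intros continuous_on_subset[OF \<sigma>]) auto
    show "\<bar>H x r * \<sigma> r\<bar> \<le> B" if "r \<in> {a<..<b} - {x}" for r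
      using that B by (auto simp: H_def)
  qed
  have L_int: "integrable (Lam a b) (\<lambda>r. L x r * \<sigma> r)" if "x \<in> {a..b}" for x
    using Bochner_Integration.integrable_diff[OF integrable_K[of "n - 1" x \<sigma>] H_int[of x]] that \<sigma>
    by (simp add: L_def left_diff_distrib)
  have L_deriv: "((\<lambda>x. L x r) has_vector_derivative K n x r) (at x within {a..b})"
    if "r \<in> {a<..<b}" "x \<in> {a..b} - {r}" for r x
  proof -
    have "((\<lambda>y. K (n - 1) y r - H x r) has_vector_derivative K n x r) (at x within {a..b})"
      using K_deriv[of "n - 1" x r] that n2
      by (simp add: has_vector_derivative_diff_const)
    moreover have "\<forall>y\<in>{a..b}. dist y x < dist r x \<longrightarrow> K (n - 1) y r - H x r = L y r"
      by (auto simp: L_def H_def dist_real_def)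
    ultimately show ?thesis
      using has_vector_derivative_transform_within[of _ "K n x r" x "{a..b}" "dist r x" "\<lambda>x. L x r"] that
      by auto
  qed
  have L_lip: "\<bar>L x r - L y r\<bar> \<le> C * \<bar>x - y\<bar>"
    if r: "r \<in> {a<..<b}" and xy: "x \<in> {a..b} - {r}" "y \<in> {a..b} - {r}" for r x y
  proof -
    obtain q where q: "((\<lambda>t. K (n - 1) t r) \<longlongrightarrow> q) (at_left r)"
      "((\<lambda>t. K (n - 1) t r) \<longlongrightarrow> q + 1) (at_right r)"
      using K_jump[OF r] .
    have 1: "((\<lambda>t. L t r) \<longlongrightarrow> q) (at_left r)"
      by (rule Lim_transform_eventually[OF q(1)])
        (use eventually_at_side(1)[OF r] in \<open>eventually_elim, auto simp: L_def H_def\<close>)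
    have "((\<lambda>t. K (n - 1) t r - 1) \<longlongrightarrow> q + 1 - 1) (at_right r)"
      by (intro tendsto_intros q)
    then have "((\<lambda>t. K (n - 1) t r - 1) \<longlongrightarrow> q) (at_right r)"
      by simp
    then have 2: "((\<lambda>t. L t r) \<longlongrightarrow> q) (at_right r)"
      by (rule Lim_transform_eventually)
        (use eventually_at_side(2)[OF r] in \<open>eventually_elim, auto simp: L_def H_def\<close>)
    show ?thesis
      by (rule real_lipschitz_off_point[OF L_deriv _ 1 2 xy]) (use r C in auto)
  qed
  have "((\<lambda>x. \<integral>r. L x r * \<sigma> r \<partial>Lam a b) has_vector_derivative S n \<sigma> t) (at t within {a..b})"
    unfolding green_op_def
  proof (rule has_vector_derivative_integral_Lam[OF t L_lip L_int])
    show "(\<lambda>r. K n t r * \<sigma> r) \<in> borel_measurable (Lam a b)"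
      by (intro borel_measurable_integrable integrable_K t \<sigma> order_refl)
    show "((\<lambda>x. L x r) has_vector_derivative K n t r) (at t within {a..b})"
      if "r \<in> {a<..<b} - {t}" for r
      using that t by (intro L_deriv) auto
    show "\<bar>\<sigma> r\<bar> \<le> B" if "r \<in> {a<..<b}" for r
      using that by (intro B) auto
  qed
  moreover have "((\<lambda>x. integral {a..x} \<sigma>) has_vector_derivative \<sigma> t) (at t within {a..b})"
    by (rule integral_has_vector_derivative[OF \<sigma> t])
  ultimately have deriv: "((\<lambda>x. (\<integral>r. L x r * \<sigma> r \<partial>Lam a b) + integral {a..x} \<sigma>)
      has_vector_derivative S n \<sigma> t + \<sigma> t) (at t within {a..b})"
    by (rule has_vector_derivative_add)
  have eq: "S (n - 1) \<sigma> x = (\<integral>r. L x r * \<sigma> r \<partial>Lam a b) + integral {a..x} \<sigma>" if x: "x \<in> {a..b}" for x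
  proof -
    have "(\<integral>r. L x r * \<sigma> r \<partial>Lam a b) + (\<integral>r. H x r * \<sigma> r \<partial>Lam a b) =
        (\<integral>r. L x r * \<sigma> r + H x r * \<sigma> r \<partial>Lam a b)"
      using L_int[OF x] H_int[of x] by simp
    also have "\<dots> = S (n - 1) \<sigma> x"
      unfolding green_op_def by (simp add: L_def algebra_simps)
    finally show ?thesis
      using integral_Lam_lessThan[OF \<sigma> x] by (simp add: H_def)
  qed
  show ?thesis
    by (rule has_vector_derivative_transform[OF t eq deriv])
qed

lemma continuous_on_green_op:
  assumes "k < n" "continuous_on {a..b} \<sigma>"
  shows "continuous_on {a..b} (S k \<sigma>)"
proof -
  have "\<exists>D. (S k \<sigma> has_vector_derivative D) (at t within {a..b})" if "t \<in> {a..b}" for t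
  proof (cases "k = n - 1")
    case True
    then show ?thesis
      using green_op_deriv_top[OF that assms(2)] by blast
  next
    case False
    then have "k < n - 1"
      using assms(1) by simp
    then show ?thesis
      using green_op_deriv[OF _ that assms(2)] by blast
  qed
  then show ?thesis
    using has_vector_derivative_continuous unfolding continuous_on_eq_continuous_within by blast
qed

lemma
  assumes \<sigma>: "continuous_on {a..b} \<sigma>"
  shows Dk_green_op: "k < n \<Longrightarrow> t \<in> {a..b} \<Longrightarrow> Dk a b k (S 0 \<sigma>) t = S k \<sigma> t"
    and green_op_solution: "bvp_solution a b n c \<alpha> \<beta> M \<sigma> (S 0 \<sigma>)"
proof -
  \<comment> \<open>The candidate chain of derivatives: only the top order picks up \<sigma>, from
    the jump.\<close>
  define U where "U j = (\<lambda>t. if j = n then S n \<sigma> t + \<sigma> t else S j \<sigma> t)" for j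
  have d: "(U j has_vector_derivative U (Suc j) t) (at t within {a..b})" if "j < n" "t \<in> {a..b}" for j t
  proof (cases "j = n - 1")
    case True
    then have "U j = S (n - 1) \<sigma>" "U (Suc j) t = S n \<sigma> t + \<sigma> t"
      using n2 by (auto simp: U_def)
    then show ?thesis
      using green_op_deriv_top[OF that(2) \<sigma>] by simp
  next
    case False
    then have "U j = S j \<sigma>" "U (Suc j) t = S (Suc j) \<sigma> t" "j < n - 1"
      using that(1) by (auto simp: U_def)
    then show ?thesis
      using green_op_deriv[of j, OF _ that(2) \<sigma>] by simp
  qed
  have U0: "S 0 \<sigma> t = U 0 t" for t
    using n2 by (simp add: U_def)
  have U_cont: "continuous_on {a..b} (U j)" if "j \<le> n" for j
  proof (cases "j = n")
    case True
    have "continuous_on {a..b} (S (n - k) \<sigma>)" if "k \<in> {1..n}" for k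
      by (rule continuous_on_green_op[OF _ \<sigma>]) (use that in auto)
    moreover have "continuous_on {a..b} (S 0 \<sigma>)"
      by (rule continuous_on_green_op[OF _ \<sigma>]) (use n2 in auto)
    \<comment> \<open>\<open>continuous_on_green_op\<close> stops at order n - 1. Order n is
      continuous because the equation expresses it through the lower ones.\<close>
    ultimately have "continuous_on {a..b}
        (\<lambda>t. - (\<Sum>k = 1..n. c k t * S (n - k) \<sigma> t) - M * S 0 \<sigma> t + \<sigma> t)"
      by (intro continuous_intros \<sigma> coeffs)
    then show ?thesis
      by (rule continuous_on_eq) (simp only: U_def True green_op_top[OF _ \<sigma>] simp_thms if_True)
  next
    case False
    then show ?thesis
      using continuous_on_green_op[of j, OF _ \<sigma>] that by (simp add: U_def)
  qed
  have chain: "Dk a b k (S 0 \<sigma>) t = U k t" if "k \<le> n" "t \<in> {a..b}" for k t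
    using Dk_chain(1)[where U = U, OF ab openin_Icc U0 d that] .
  show Dk: "k < n \<Longrightarrow> t \<in> {a..b} \<Longrightarrow> Dk a b k (S 0 \<sigma>) t = S k \<sigma> t" for k t
    using chain[of k t] by (simp add: U_def)
  have "T_op a b n c M (S 0 \<sigma>) t = \<sigma> t" if t: "t \<in> {a..b}" for t
  proof -
    have "Dk a b n (S 0 \<sigma>) t = S n \<sigma> t + \<sigma> t"
      using chain[of n t] t by (simp add: U_def)
    moreover have "(\<Sum>k = 1..n. c k t * Dk a b (n - k) (S 0 \<sigma>) t) = (\<Sum>k = 1..n. c k t * S (n - k) \<sigma> t)"
      by (rule sum.cong) (use Dk t in auto)
    ultimately show ?thesis
      using green_op_top[OF t \<sigma>] by (simp add: T_op_def)
  qed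
  moreover have "B_op a b n \<alpha> \<beta> i (S 0 \<sigma>) = 0" if i: "i \<in> {1..n}" for i
  proof -
    have "B_op a b n \<alpha> \<beta> i (S 0 \<sigma>) = (\<Sum>j<n. \<alpha> i j * S j \<sigma> a + \<beta> i j * S j \<sigma> b)"
      unfolding B_op_def by (rule sum.cong) (use Dk ab in auto)
    also have "\<dots> = (\<integral>r. (\<Sum>j<n. \<alpha> i j * (K j a r * \<sigma> r) + \<beta> i j * (K j b r * \<sigma> r)) \<partial>Lam a b)"
      using integrable_K[of _ a \<sigma>] integrable_K[of _ b \<sigma>] \<sigma> ab
      by (subst Bochner_Integration.integral_sum) (auto simp: green_op_def)
    also have "\<dots> = (\<integral>r. 0 \<partial>Lam a b)"
    proof (rule Bochner_Integration.integral_cong[OF refl])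
      fix r assume "r \<in> space (Lam a b)"
      then have "B_op a b n \<alpha> \<beta> i (\<lambda>t. g t r) = 0"
        using green_sectionD(1)[of r] i by (simp add: green_section_def)
      then have "(\<Sum>j<n. \<alpha> i j * K j a r + \<beta> i j * K j b r) * \<sigma> r = 0"
        by (simp add: B_op_def K_eq)
      then show "(\<Sum>j<n. \<alpha> i j * (K j a r * \<sigma> r) + \<beta> i j * (K j b r * \<sigma> r)) = 0"
        by (simp only: sum_distrib_right distrib_right mult.assoc)
    qed
    finally show ?thesis
      by simp
  qed
  moreover have "Ck_on a b n {a..b} (S 0 \<sigma>)"
    by (rule Ck_on_chainI[where U = U, OF ab openin_Icc U0 d U_cont])
  ultimately show "bvp_solution a b n c \<alpha> \<beta> M \<sigma> (S 0 \<sigma>)"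
    by (simp add: bvp_solution_def)
qed

text \<open>Uniqueness of sections passes to the problem itself. The difference \<open>w\<close> of
  two solutions solves the homogeneous problem, and its derivative of order n - 1 is continuous, so
  adding \<open>w\<close> to a section keeps all the conditions on it, the unit jump included. Hence
  \<open>w\<close> vanishes off \<open>s\<close>.\<close>

lemma bvp_unique:
  assumes u: "bvp_solution a b n c \<alpha> \<beta> M \<sigma> u" and v: "bvp_solution a b n c \<alpha> \<beta> M \<sigma> v"
    and t: "t \<in> {a..b}"
  shows "u t = v t"
proof -
  define w where "w t = 1 * u t + (- 1) * v t" for t
  note Cu = u[unfolded bvp_solution_def, THEN conjunct1]
  note Cv = v[unfolded bvp_solution_def, THEN conjunct1]
  have Cw: "Ck_on a b n {a..b} w"
    unfolding w_def by (rule Ck_on_lincomb[OF ab openin_Icc Cu Cv])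
  have Tw: "T_op a b n c M w t = 0" if "t \<in> {a..b}" for t
    unfolding w_def using T_op_lincomb[OF ab openin_Icc Cu Cv that, of c M 1 "-1"] u v that
    by (simp add: bvp_solution_def)
  have Bw: "B_op a b n \<alpha> \<beta> i w = 0" if "i \<in> {1..n}" for i
    unfolding w_def
    by (subst B_op_lincomb[OF Dk_lincomb[OF ab openin_Icc Cu Cv]])
      (use ab u v that in \<open>auto simp: bvp_solution_def\<close>)
  have w0: "w t = 0" if s: "s \<in> {a<..<b}" and t: "t \<in> {a..b} - {s}" for s t
  proof -
    let ?J = "{a..b} - {s}"
    have mono: "Ck_on a b m J w" if "m \<le> n" "J \<subseteq> {a..b}" for m J
      using Cw that unfolding Ck_on_def by (meson continuous_on_subset le_trans less_le_trans subsetD)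
    note gs = green_sectionD(1)[OF s, unfolded green_section_def]
    have gJ: "Ck_on a b n ?J (\<lambda>t. g t s)" and gI: "Ck_on a b (n - 2) {a..b} (\<lambda>t. g t s)"
      using gs n2 by auto
    define h where "h t = 1 * g t s + 1 * w t" for t
    have Dh: "Dk a b j h t = Dk a b j (\<lambda>t. g t s) t + Dk a b j w t" if "j \<le> n" "t \<in> ?J" for j t
      unfolding h_def
      using Dk_lincomb[OF ab openin_Icc_minus gJ mono[of n ?J] that, of 1 1] by auto
    have "green_section a b n c \<alpha> \<beta> M s h"
      unfolding green_section_def
    proof (intro conjI impI ballI)
      show "Ck_on a b (n - 2) {a..b} h"
        unfolding h_def by (rule Ck_on_lincomb[OF ab openin_Icc gI mono]) auto
      show "Ck_on a b n ?J h"
        unfolding h_def by (rule Ck_on_lincomb[OF ab openin_Icc_minus gJ mono]) auto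
      show "T_op a b n c M h t = 0" if "t \<in> ?J" for t
        unfolding h_def
      proof -
        have "T_op a b n c M (\<lambda>t. g t s) t = 0" "T_op a b n c M w t = 0"
          using gs Tw that by blast+
        then show "T_op a b n c M (\<lambda>t. 1 * g t s + 1 * w t) t = 0"
          by (subst T_op_lincomb[OF ab openin_Icc_minus gJ mono that]) auto
      qed
      show "B_op a b n \<alpha> \<beta> i h = 0" if "i \<in> {1..n}" for i
      proof -
        have "B_op a b n \<alpha> \<beta> i h = 1 * B_op a b n \<alpha> \<beta> i (\<lambda>t. g t s) + 1 * B_op a b n \<alpha> \<beta> i w"
        proof (rule B_op_lincomb)
          fix j t assume "j < n" "t \<in> {a, b}"
          then show "Dk a b j h t = 1 * Dk a b j (\<lambda>t. g t s) t + 1 * Dk a b j w t"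
            using Dh[of j t] s by auto
        qed
        moreover have "B_op a b n \<alpha> \<beta> i (\<lambda>t. g t s) = 0"
          using gs that by blast
        ultimately show ?thesis
          using Bw[OF that] by simp
      qed
      obtain p q where pq: "(Dk a b (n - 1) (\<lambda>t. g t s) \<longlongrightarrow> p) (at_left s)"
        "(Dk a b (n - 1) (\<lambda>t. g t s) \<longlongrightarrow> q) (at_right s)" "q - p = 1"
        using gs by blast
      have "continuous_on {a..b} (Dk a b (n - 1) w)"
        using Ck_on_cont[OF Cw] by simp
      then have "isCont (Dk a b (n - 1) w) s"
        using s by (auto intro: continuous_on_interior)
      then have wl: "(Dk a b (n - 1) w \<longlongrightarrow> Dk a b (n - 1) w s) (at_left s)"
        "(Dk a b (n - 1) w \<longlongrightarrow> Dk a b (n - 1) w s) (at_right s)"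
        by (auto simp: isCont_def filterlim_at_split)
      have "(Dk a b (n - 1) h \<longlongrightarrow> p + Dk a b (n - 1) w s) (at_left s)"
        by (rule Lim_transform_eventually[OF tendsto_add[OF pq(1) wl(1)]])
          (rule eventually_mono[OF eventually_at_side(1)[OF s]], use s in \<open>auto simp: Dh\<close>)
      moreover have "(Dk a b (n - 1) h \<longlongrightarrow> q + Dk a b (n - 1) w s) (at_right s)"
        by (rule Lim_transform_eventually[OF tendsto_add[OF pq(2) wl(2)]])
          (rule eventually_mono[OF eventually_at_side(2)[OF s]], use s in \<open>auto simp: Dh\<close>)
      ultimately show "\<exists>p q. (Dk a b (n - 1) h \<longlongrightarrow> p) (at_left s) \<and>
          (Dk a b (n - 1) h \<longlongrightarrow> q) (at_right s) \<and> q - p = 1"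
        using pq(3)
        by (intro exI[of _ "p + Dk a b (n - 1) w s"] exI[of _ "q + Dk a b (n - 1) w s"] conjI) auto
    qed
    then have "h t = g t s"
      using green_sectionD(2)[OF s _ t] by blast
    then show ?thesis
      by (simp add: h_def)
  qed
  \<comment> \<open>Two interior choices of \<open>s\<close> suffice, so that one of them differs
    from \<open>t\<close>.\<close>
  have "w t = 0"
  proof (cases "t = (a + b) / 2")
    case True
    then show ?thesis
      using w0[of "(2 * a + b) / 3" t] t ab by (auto simp: field_simps)
  next
    case False
    then show ?thesis
      using w0[of "(a + b) / 2" t] t ab by (auto simp: field_simps)
  qed
  then show ?thesis
    by (simp add: w_def)
qed

text \<open>If order \<open>l\<close> vanished off the diagonal, so would all orders up to n - 1,
  and then there could be no unit jump.\<close>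

lemma K_nontrivial:
  assumes "l < n"
  shows "\<exists>s\<in>{a<..<b}. \<exists>t\<in>{a..b} - {s}. K l t s \<noteq> 0"
proof (rule ccontr)
  assume "\<not> ?thesis"
  then have l0: "K l t s = 0" if "s \<in> {a<..<b}" "t \<in> {a..b} - {s}" for s t
    using that by blast
  define s where "s = (a + b) / 2"
  have s: "s \<in> {a<..<b}"
    using ab by (auto simp: s_def)
  have zero: "K (l + j) t s = 0" if "l + j < n" "t \<in> {a..b} - {s}" for j t
    using that
  proof (induction j arbitrary: t)
    case 0
    then show ?case
      using l0[OF s] by simp
  next
    case (Suc j)
    have "((\<lambda>r. K (l + j) r s) has_vector_derivative K (Suc (l + j)) t s) (at t within {a..b})"
      using Suc.prems s by (intro K_deriv) auto
    moreover have "((\<lambda>r. K (l + j) r s) has_vector_derivative 0) (at t within {a..b})"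
      by (rule has_vector_derivative_transform_openin[OF openin_Icc_minus Suc.prems(2), of "\<lambda>_. 0"])
        (use Suc in auto)
    ultimately show ?case
      using vector_derivative_within_cbox[of a b t "\<lambda>r. K (l + j) r s" "K (Suc (l + j)) t s"]
        vector_derivative_within_cbox[of a b t "\<lambda>r. K (l + j) r s" 0] ab Suc.prems(2)
      by auto
  qed
  obtain p where p: "((\<lambda>t. K (n - 1) t s) \<longlongrightarrow> p) (at_left s)"
    "((\<lambda>t. K (n - 1) t s) \<longlongrightarrow> p + 1) (at_right s)"
    using K_jump[OF s] .
  have z: "K (n - 1) t s = 0" if "t \<in> {a..b} - {s}" for t
    using zero[of "n - 1 - l" t] that assms by simp
  have "((\<lambda>t. 0) \<longlongrightarrow> p) (at_left s)"
    by (rule Lim_transform_eventually[OF p(1)])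
      (rule eventually_mono[OF eventually_at_side(1)[OF s] z], use s in auto)
  moreover have "((\<lambda>t. 0) \<longlongrightarrow> p + 1) (at_right s)"
    by (rule Lim_transform_eventually[OF p(2)])
      (rule eventually_mono[OF eventually_at_side(2)[OF s] z], use s in auto)
  ultimately have "p = 0" "p + 1 = 0"
    by (auto simp: tendsto_const_iff)
  then show False
    by simp
qed

end

section \<open>The resolvent identity\<close>

text \<open>The operators for M1 and M2 differ by the multiple M1 - M2 of the identity. So the
  solution y for M2 with right-hand side \<sigma> solves the problem for M1 with right-hand side
  \<sigma> + (M1 - M2) y, and uniqueness for M1 identifies the two.\<close>

lemma green_op_resolvent:
  assumes "green_function a b n c \<alpha> \<beta> M1 g1" "green_function a b n c \<alpha> \<beta> M2 g2"
    and \<sigma>: "continuous_on {a..b} \<sigma>" and l: "l < n" and t: "t \<in> {a..b}"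
  shows "green_op a b g2 l \<sigma> t = green_op a b g1 l \<sigma> t
    + (M1 - M2) * green_op a b g1 l (green_op a b g2 0 \<sigma>) t"
proof -
  interpret G1: green_function a b n c \<alpha> \<beta> M1 g1 by fact
  interpret G2: green_function a b n c \<alpha> \<beta> M2 g2 by fact
  let ?y = "G2.S 0 \<sigma>"
  let ?\<tau> = "\<lambda>r. 1 * \<sigma> r + (M1 - M2) * ?y r"
  have y: "continuous_on {a..b} ?y"
    using G2.continuous_on_green_op[OF _ \<sigma>, of 0] l by simp
  have \<tau>: "continuous_on {a..b} ?\<tau>"
    by (intro continuous_intros \<sigma> y)
  have "bvp_solution a b n c \<alpha> \<beta> M1 ?\<tau> ?y"
    using G2.green_op_solution[OF \<sigma>] by (auto simp: bvp_solution_def T_op_def algebra_simps)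
  then have eq: "?y t = G1.S 0 ?\<tau> t" if "t \<in> {a..b}" for t
    using G1.bvp_unique[OF _ G1.green_op_solution[OF \<tau>] that] by blast
  have "G2.S l \<sigma> t = Dk a b l ?y t"
    using G2.Dk_green_op[OF \<sigma> l t] by simp
  also have "\<dots> = Dk a b l (G1.S 0 ?\<tau>) t"
    using G1.green_op_solution[OF \<tau>] l t
    by (intro Dk_cong[OF G1.ab openin_Icc _ eq, of n]) (auto simp: bvp_solution_def)
  also have "\<dots> = G1.S l ?\<tau> t"
    by (rule G1.Dk_green_op[OF \<tau> l t])
  also have "\<dots> = 1 * G1.S l \<sigma> t + (M1 - M2) * G1.S l ?y t"
    using l t \<sigma> y by (intro G1.green_op_lincomb) auto
  finally show ?thesis
    by simp
qed

section \<open>From integrals back to pointwise signs\<close>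

lemma pos_near_within:
  fixes f :: "real \<Rightarrow> real"
  assumes "continuous (at s within S) f" "f s > 0"
  obtains d where "d > 0" "\<And>r. r \<in> S \<Longrightarrow> \<bar>r - s\<bar> < d \<Longrightarrow> f r > f s / 2"
proof -
  have "f s / 2 > 0"
    using assms(2) by simp
  then obtain d where d: "d > 0" "\<forall>r\<in>S. dist r s < d \<longrightarrow> dist (f r) (f s) < f s / 2"
    using assms(1) unfolding continuous_within_eps_delta by blast
  show ?thesis
  proof (rule that[OF d(1)])
    fix r assume "r \<in> S" "\<bar>r - s\<bar> < d"
    then have "\<bar>f r - f s\<bar> < f s / 2"
      using d(2) by (simp add: dist_real_def)
    then show "f r > f s / 2"
      by linarith
  qed
qed

lemma subinterval_near:
  fixes a b s d :: real
  assumes "a < b" "s \<in> {a..b}" "d > 0"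
  obtains x y where "x < y" "a \<le> x" "y \<le> b" "{x<..<y} \<subseteq> {s - d<..<s + d}"
  using assms by (intro that[of "max a (s - d)" "min b (s + d)"]) auto

lemma integral_Lam_pos_at:
  fixes f :: "real \<Rightarrow> real"
  assumes "a < b" "s \<in> {a..b}" "continuous (at s within {a..b}) f" "f s > 0"
    and "integrable (Lam a b) f" "AE r in Lam a b. 0 \<le> f r"
  shows "(\<integral>r. f r \<partial>Lam a b) > 0"
proof -
  obtain d where d: "d > 0" "\<And>r. r \<in> {a..b} \<Longrightarrow> \<bar>r - s\<bar> < d \<Longrightarrow> f r > f s / 2"
    using pos_near_within[OF assms(3,4)] by blast
  obtain x y where xy: "x < y" "a \<le> x" "y \<le> b" "{x<..<y} \<subseteq> {s - d<..<s + d}"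
    using subinterval_near[OF assms(1,2) d(1)] by blast
  have "f s / 2 \<le> f r" if "r \<in> {x<..<y}" for r
  proof -
    have "r \<in> {a..b}" "\<bar>r - s\<bar> < d"
      using subsetD[OF xy(4) that] that xy(2,3) by auto
    then show ?thesis
      using d(2)[of r] by linarith
  qed
  then show ?thesis
    using integral_Lam_pos[OF assms(5,6) xy(1-3), of "f s / 2"] assms(4) by simp
qed

text \<open>If \<open>f s\<close> were positive, a tent function supported where \<open>f\<close>
  exceeds half that value would give a positive integral. Continuity is required at \<open>s\<close>
  only, because a slice of order n - 1 may jump on the diagonal.\<close>

lemma nonpos_of_integral_Lam:
  fixes f :: "real \<Rightarrow> real"
  assumes ab: "a < b" and s: "s \<in> {a..b}" and f: "continuous (at s within {a..b}) f"
    and int: "\<And>\<sigma>. continuous_on {a..b} \<sigma> \<Longrightarrow> integrable (Lam a b) (\<lambda>r. f r * \<sigma> r)"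
    and le: "\<And>\<sigma>. continuous_on {a..b} \<sigma> \<Longrightarrow> (\<And>r. r \<in> {a..b} \<Longrightarrow> 0 \<le> \<sigma> r) \<Longrightarrow>
      (\<integral>r. f r * \<sigma> r \<partial>Lam a b) \<le> 0"
  shows "f s \<le> 0"
proof (rule ccontr)
  assume "\<not> f s \<le> 0"
  then have fs: "f s > 0"
    by simp
  obtain d where d: "d > 0" "\<And>r. r \<in> {a..b} \<Longrightarrow> \<bar>r - s\<bar> < d \<Longrightarrow> f r > f s / 2"
    using pos_near_within[OF f fs] by blast
  define \<sigma> where "\<sigma> r = max 0 (d - \<bar>r - s\<bar>)" for r
  have \<sigma>: "continuous_on A \<sigma>" for A
    unfolding \<sigma>_def by (intro continuous_intros)
  have nn: "0 \<le> f r * \<sigma> r" if "r \<in> {a..b}" for r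
  proof (cases "\<bar>r - s\<bar> < d")
    case True
    then show ?thesis
      using d(2)[OF that True] fs by (intro mult_nonneg_nonneg) (auto simp: \<sigma>_def)
  qed (simp add: \<sigma>_def)
  have "0 < (\<integral>r. f r * \<sigma> r \<partial>Lam a b)"
  proof (rule integral_Lam_pos_at[OF ab s])
    show "continuous (at s within {a..b}) (\<lambda>r. f r * \<sigma> r)"
      using \<sigma>[of "{a..b}"] s by (intro continuous_intros f) (simp add: continuous_on_eq_continuous_within)
    show "0 < f s * \<sigma> s"
      using fs d(1) by (simp add: \<sigma>_def)
    show "AE r in Lam a b. 0 \<le> f r * \<sigma> r"
      using nn by (intro AE_I2) auto
  qed (rule int[OF \<sigma>])
  moreover have "(\<integral>r. f r * \<sigma> r \<partial>Lam a b) \<le> 0"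
    by (rule le[OF \<sigma>]) (simp add: \<sigma>_def)
  ultimately show False
    by simp
qed

lemma green_dom_subset: "green_dom a b n l \<subseteq> {a..b} \<times> {a..b}"
  by (auto simp: green_dom_def off_diag_def)

context green_function
begin

text \<open>Provides the continuity in s that pointwise recovery needs, at exactly the points where
  \<open>green_dom\<close> asks for a sign; the end points of I are included.\<close>

lemma continuous_K_dom:
  assumes l: "l < n" and ts: "(t, s) \<in> green_dom a b n l"
  shows "continuous (at s within {a..b}) (K l t)"
proof (cases "l = n - 1")
  case True
  then have *: "t \<in> {a..b}" "s \<in> {a..b} - {t}"
    using ts by (auto simp: green_dom_def off_diag_def)
  have "at s within {a..b} = at s within ({a..b} - {t})"
    by (rule at_within_nhd[of s "- {t}"]) (use * in auto)
  then show ?thesis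
    using continuous_on_K_slice[of l t] l * by (simp add: continuous_on_eq_continuous_within)
next
  case False
  then have *: "t \<in> {a..b}" "s \<in> {a..b}" and k: "l \<le> n - 2"
    using ts l by (auto simp: green_dom_def)
  have "continuous_on {a..b} (K l t)"
    by (rule continuous_on_compose2[OF continuous_on_K_square[OF k], of _ "Pair t", simplified])
      (use * in \<open>auto intro!: continuous_intros\<close>)
  then show ?thesis
    using * by (simp add: continuous_on_eq_continuous_within)
qed

lemma green_op_nonpos:
  assumes "k \<le> n" "t \<in> {a..b}" "continuous_on {a..b} \<sigma>" "\<And>r. r \<in> {a..b} \<Longrightarrow> 0 \<le> \<sigma> r"
    and "\<And>r. r \<in> {a<..<b} - {t} \<Longrightarrow> e * K k t r \<le> 0"
  shows "e * S k \<sigma> t \<le> 0"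
proof -
  have "0 \<le> (\<integral>r. - (e * (K k t r * \<sigma> r)) \<partial>Lam a b)"
  proof (rule integral_nonneg_AE)
    show "AE r in Lam a b. 0 \<le> - (e * (K k t r * \<sigma> r))"
      using AE_Lam_neq[of "{t}" a b, simplified] AE_space
    proof eventually_elim
      case (elim r)
      then have "e * K k t r * \<sigma> r \<le> 0"
        by (intro mult_nonpos_nonneg[of "e * K k t r" "\<sigma> r"] assms(4,5)) auto
      then show ?case
        by (simp add: mult.assoc)
    qed
  qed
  then show ?thesis
    using integrable_K[OF assms(1-3)] by (simp add: green_op_def)
qed

lemma green_op_scale:
  assumes "k \<le> n" "t \<in> {a..b}" "continuous_on {a..b} \<sigma>"
  shows "S k (\<lambda>r. p * \<sigma> r) t = p * S k \<sigma> t"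
  using green_op_lincomb[OF assms assms(3), of p 0] by simp

text \<open>The strictness part of the maximum principle: an integrand of constant sign with
  integral zero vanishes wherever it is continuous, and at \<open>s\<close> the kernel factor is not
  zero.\<close>

lemma green_op_eq_0D:
  assumes l: "l < n" and t: "t \<in> {a..b}" and v: "continuous_on {a..b} v"
    and v0: "\<And>r. r \<in> {a..b} \<Longrightarrow> 0 \<le> v r"
    and neg: "\<And>r. r \<in> {a<..<b} - {t} \<Longrightarrow> e * K l t r \<le> 0"
    and 0: "e * S l v t = 0" and ts: "(t, s) \<in> green_dom a b n l"
    and "s \<in> {a<..<b}" and K0: "e * K l t s < 0"
  shows "v s = 0"
proof (rule ccontr)
  assume "v s \<noteq> 0"
  then have vs: "v s > 0"
    using v0[of s] \<open>s \<in> _\<close> by force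
  have "0 < (\<integral>r. - (e * K l t r) * v r \<partial>Lam a b)"
  proof (rule integral_Lam_pos_at[OF ab])
    show "s \<in> {a..b}"
      using \<open>s \<in> _\<close> by simp
    then show "continuous (at s within {a..b}) (\<lambda>r. - (e * K l t r) * v r)"
      using v by (intro continuous_intros continuous_K_dom[OF l ts])
        (simp add: continuous_on_eq_continuous_within)
    show "0 < - (e * K l t s) * v s"
      using vs K0 by (simp add: mult_neg_pos)
    show "integrable (Lam a b) (\<lambda>r. - (e * K l t r) * v r)"
      using integrable_K[of l t v] l t v by (simp add: mult.assoc)
    show "AE r in Lam a b. 0 \<le> - (e * K l t r) * v r"
      using AE_Lam_neq[of "{t}" a b, simplified] AE_space
    proof eventually_elim
      case (elim r)
      then show ?case
        using neg[of r] v0[of r] by (intro mult_nonneg_nonneg) auto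
    qed
  qed
  moreover have "(\<integral>r. - (e * K l t r) * v r \<partial>Lam a b) = - (e * S l v t)"
    using integrable_K[of l t v] l t v by (simp add: green_op_def mult.assoc)
  ultimately show False
    using 0 by simp
qed

end

text \<open>The two weights cover both uses: q = 0 yields the sign of one kernel, and q = - p
  compares two of them.\<close>

lemma kernel_le_of_green_op_le:
  assumes "green_function a b n c \<alpha> \<beta> M1 g1" "green_function a b n c \<alpha> \<beta> M2 g2"
    and l: "l < n" and ts: "(t, s) \<in> green_dom a b n l"
    and le: "\<And>\<sigma>. continuous_on {a..b} \<sigma> \<Longrightarrow> (\<And>r. r \<in> {a..b} \<Longrightarrow> 0 \<le> \<sigma> r) \<Longrightarrow>
      p * green_op a b g1 l \<sigma> t + q * green_op a b g2 l \<sigma> t \<le> 0"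
  shows "p * tderiv a b l g1 t s + q * tderiv a b l g2 t s \<le> 0"
proof -
  interpret G1: green_function a b n c \<alpha> \<beta> M1 g1 by fact
  interpret G2: green_function a b n c \<alpha> \<beta> M2 g2 by fact
  have t: "t \<in> {a..b}" and s: "s \<in> {a..b}"
    using ts green_dom_subset by blast+
  have split: "(\<lambda>r. (p * G1.K l t r + q * G2.K l t r) * \<sigma> r) =
      (\<lambda>r. p * (G1.K l t r * \<sigma> r) + q * (G2.K l t r * \<sigma> r))" for \<sigma>
    by (simp add: algebra_simps)
  show ?thesis
  proof (rule nonpos_of_integral_Lam[OF G1.ab s, of "\<lambda>s. p * G1.K l t s + q * G2.K l t s"])
    show "continuous (at s within {a..b}) (\<lambda>s. p * G1.K l t s + q * G2.K l t s)"
      by (intro continuous_intros G1.continuous_K_dom[OF l ts] G2.continuous_K_dom[OF l ts])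
    fix \<sigma> :: "real \<Rightarrow> real" assume \<sigma>: "continuous_on {a..b} \<sigma>"
    note int = G1.integrable_K[OF less_imp_le[OF l] t \<sigma>] G2.integrable_K[OF less_imp_le[OF l] t \<sigma>]
    show "integrable (Lam a b) (\<lambda>r. (p * G1.K l t r + q * G2.K l t r) * \<sigma> r)"
      unfolding split using int by simp
    assume "\<And>r. r \<in> {a..b} \<Longrightarrow> 0 \<le> \<sigma> r"
    then show "(\<integral>r. (p * G1.K l t r + q * G2.K l t r) * \<sigma> r \<partial>Lam a b) \<le> 0"
      unfolding split using int le[OF \<sigma>] by (simp add: green_op_def)
  qed
qed

section \<open>Sign sets as the parameter varies\<close>

text \<open>The factor \<open>e\<close> treats both halves of the claim at once: 1 gives N_l and -1
  gives P_l.\<close>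

definition sgn_set :: "real \<Rightarrow> real \<Rightarrow> nat \<Rightarrow> (nat \<Rightarrow> real \<Rightarrow> real)
    \<Rightarrow> (nat \<Rightarrow> nat \<Rightarrow> real) \<Rightarrow> (nat \<Rightarrow> nat \<Rightarrow> real) \<Rightarrow> real \<Rightarrow> nat \<Rightarrow> real set" where
  "sgn_set a b n c \<alpha> \<beta> e l = {M. has_green a b n c \<alpha> \<beta> M \<and>
     (\<forall>(t, s)\<in>green_dom a b n l. e * tderiv a b l (green a b n c \<alpha> \<beta> M) t s \<le> 0)}"

lemma N_set_eq_sgn_set: "N_set a b n c \<alpha> \<beta> l = sgn_set a b n c \<alpha> \<beta> 1 l"
  by (simp add: N_set_def sgn_set_def)

lemma P_set_eq_sgn_set: "P_set a b n c \<alpha> \<beta> l = sgn_set a b n c \<alpha> \<beta> (- 1) l"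
  by (simp add: P_set_def sgn_set_def)

locale bvp_family =
  fixes a b :: real and n :: nat and c :: "nat \<Rightarrow> real \<Rightarrow> real"
    and \<alpha> \<beta> :: "nat \<Rightarrow> nat \<Rightarrow> real"
  assumes ab: "a < b" and n2: "2 \<le> n"
    and coeffs: "\<And>k. k \<in> {1..n} \<Longrightarrow> continuous_on {a..b} (c k)"
begin

abbreviation G :: "real \<Rightarrow> real \<Rightarrow> real \<Rightarrow> real" where "G \<equiv> green a b n c \<alpha> \<beta>"
abbreviation S :: "real \<Rightarrow> nat \<Rightarrow> (real \<Rightarrow> real) \<Rightarrow> real \<Rightarrow> real" where "S M \<equiv> green_op a b (G M)"
abbreviation X :: "real \<Rightarrow> nat \<Rightarrow> real set" where "X \<equiv> sgn_set a b n c \<alpha> \<beta>"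

lemma n_pos: "0 < n"
  using n2 by simp

lemma green_function_G:
  assumes "has_green a b n c \<alpha> \<beta> M"
  shows "green_function a b n c \<alpha> \<beta> M (G M)"
proof
  show "is_green a b n c \<alpha> \<beta> M (G M)"
    using assms unfolding has_green_def green_def by (rule someI_ex)
qed (use ab n2 coeffs in auto)

lemma green_function_X: "M \<in> X e l \<Longrightarrow> green_function a b n c \<alpha> \<beta> M (G M)"
  by (simp add: sgn_set_def green_function_G)

lemma X_op:
  assumes M: "M \<in> X e l" and l: "l < n" and t: "t \<in> {a..b}"
    and \<sigma>: "continuous_on {a..b} \<sigma>" "\<And>r. r \<in> {a..b} \<Longrightarrow> 0 \<le> \<sigma> r"
  shows "e * S M l \<sigma> t \<le> 0"
proof -
  interpret g: green_function a b n c \<alpha> \<beta> M "G M"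
    using green_function_X[OF M] .
  have "e * g.K l t r \<le> 0" if "r \<in> {a<..<b} - {t}" for r
    using M that t by (auto simp: sgn_set_def green_dom_def off_diag_def split: if_splits)
  then show ?thesis
    using g.green_op_nonpos[OF less_imp_le[OF l] t \<sigma>] by blast
qed

lemma X_I:
  assumes M: "has_green a b n c \<alpha> \<beta> M" and l: "l < n"
    and le: "\<And>\<sigma> t. continuous_on {a..b} \<sigma> \<Longrightarrow> (\<And>r. r \<in> {a..b} \<Longrightarrow> 0 \<le> \<sigma> r) \<Longrightarrow>
      t \<in> {a..b} \<Longrightarrow> e * S M l \<sigma> t \<le> 0"
  shows "M \<in> X e l"
proof -
  have "e * tderiv a b l (G M) t s \<le> 0" if ts: "(t, s) \<in> green_dom a b n l" for t s
    using kernel_le_of_green_op_le[OF green_function_G[OF M] green_function_G[OF M] l ts, of e 0]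
      le[of _ t] subsetD[OF green_dom_subset ts] by auto
  then show ?thesis
    using M by (auto simp: sgn_set_def)
qed

text \<open>In the resolvent identity the correction is M1 - M2 times a composition of two operators
  whose signs are both known, so its sign is that of M1 - M2. Only M2 has to be in N_0; the second
  inequality can therefore be used for an M1 above M2 whose own membership in N_0 is still
  open.\<close>

lemma op_mono:
  assumes M1: "M1 \<in> X e l" and M2: "M2 \<in> X 1 0" and l: "l < n"
    and \<sigma>: "continuous_on {a..b} \<sigma>" "\<And>r. r \<in> {a..b} \<Longrightarrow> 0 \<le> \<sigma> r" and t: "t \<in> {a..b}"
  shows "M1 \<le> M2 \<Longrightarrow> e * S M2 l \<sigma> t \<le> e * S M1 l \<sigma> t"
    and "M2 \<le> M1 \<Longrightarrow> e * S M1 l \<sigma> t \<le> e * S M2 l \<sigma> t"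
proof -
  note g1 = green_function_X[OF M1] and g2 = green_function_X[OF M2]
  let ?y = "\<lambda>r. (- 1) * S M2 0 \<sigma> r"
  have y: "continuous_on {a..b} (S M2 0 \<sigma>)"
    by (rule green_function.continuous_on_green_op[OF g2 n_pos \<sigma>(1)])
  then have "continuous_on {a..b} ?y"
    by (intro continuous_intros)
  moreover have "0 \<le> ?y r" if "r \<in> {a..b}" for r
    using X_op[OF M2 n_pos that \<sigma>] by simp
  ultimately have "e * S M1 l ?y t \<le> 0"
    using X_op[OF M1 l t] by blast
  then have pos: "e * S M1 l (S M2 0 \<sigma>) t \<ge> 0"
    using green_function.green_op_scale[OF g1 less_imp_le[OF l] t y, of "- 1"] by simp
  have eq: "e * S M2 l \<sigma> t = e * S M1 l \<sigma> t + (M1 - M2) * (e * S M1 l (S M2 0 \<sigma>) t)"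
    using arg_cong[OF green_op_resolvent[OF g1 g2 \<sigma>(1) l t], of "(*) e"]
    by (simp only: distrib_left mult.left_commute)
  show "e * S M2 l \<sigma> t \<le> e * S M1 l \<sigma> t" if "M1 \<le> M2"
    using mult_nonpos_nonneg[OF _ pos, of "M1 - M2"] that eq by simp
  show "e * S M1 l \<sigma> t \<le> e * S M2 l \<sigma> t" if "M2 \<le> M1"
    using mult_nonneg_nonneg[OF _ pos, of "M1 - M2"] that eq by simp
qed

lemma X_upward:
  assumes "M1 \<in> X e l" "M2 \<in> X 1 0" "M1 \<le> M2" "l < n"
  shows "M2 \<in> X e l"
proof (rule X_I[OF _ assms(4)])
  show "has_green a b n c \<alpha> \<beta> M2"
    using assms(2) by (simp add: sgn_set_def)
next
  fix \<sigma> :: "real \<Rightarrow> real" and t assume *: "continuous_on {a..b} \<sigma>" "\<And>r. r \<in> {a..b} \<Longrightarrow> 0 \<le> \<sigma> r" "t \<in> {a..b}"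
  show "e * S M2 l \<sigma> t \<le> 0"
    using op_mono(1)[OF assms(1,2,4) * assms(3)] X_op[OF assms(1,4) *(3,1,2)] by linarith
qed

lemma kernel_mono:
  assumes "M1 \<in> X e l" "M2 \<in> X 1 0" "M1 \<le> M2" "l < n" and ts: "(t, s) \<in> green_dom a b n l"
  shows "e * tderiv a b l (G M2) t s \<le> e * tderiv a b l (G M1) t s"
proof -
  have "t \<in> {a..b}"
    using ts green_dom_subset by blast
  then show ?thesis
    using kernel_le_of_green_op_le[OF green_function_X[OF assms(2)] green_function_X[OF assms(1)]
        \<open>l < n\<close> ts, of e "- e"] op_mono(1)[OF assms(1,2,4)] assms(3) by simp
qed

text \<open>Covers an infimum that is not known to be attained. In the resolvent identity between M
  and M' the correction is at most M' - M times a constant: on N_0 the size of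
  \<open>S M' 0 \<sigma>\<close> grows with M', so the fixed \<open>M2\<close> bounds it for all M'
  below.\<close>

lemma X_closed_below:
  assumes M: "M \<in> X 1 0" and M2: "M2 \<in> X 1 0" "M < M2" and l: "l < n"
    and approx: "\<And>\<epsilon>. \<epsilon> > 0 \<Longrightarrow> \<exists>M'\<in>X e l. M' \<in> X 1 0 \<and> M < M' \<and> M' < M + \<epsilon> \<and> M' \<le> M2"
  shows "M \<in> X e l"
proof (rule X_I[OF _ l])
  show "has_green a b n c \<alpha> \<beta> M"
    using M by (simp add: sgn_set_def)
  fix \<sigma> :: "real \<Rightarrow> real" and t assume \<sigma>: "continuous_on {a..b} \<sigma>" "\<And>r. r \<in> {a..b} \<Longrightarrow> 0 \<le> \<sigma> r" and t: "t \<in> {a..b}"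
  note g = green_function_X[OF M] and g2 = green_function_X[OF M2(1)]
  have "continuous_on {a..b} (S M2 0 \<sigma>)"
    by (rule green_function.continuous_on_green_op[OF g2 n_pos \<sigma>(1)])
  then obtain B where B: "B \<ge> 0" "\<And>r. r \<in> {a..b} \<Longrightarrow> \<bar>S M2 0 \<sigma> r\<bar> \<le> B"
    using continuous_on_bounded_real[OF compact_Icc] by blast
  obtain C where C: "C \<ge> 0" "\<And>k (\<sigma> :: real \<Rightarrow> real) B t. k \<le> n \<Longrightarrow> t \<in> {a..b} \<Longrightarrow>
      continuous_on {a..b} \<sigma> \<Longrightarrow> (\<And>r. r \<in> {a..b} \<Longrightarrow> \<bar>\<sigma> r\<bar> \<le> B) \<Longrightarrow> \<bar>S M k \<sigma> t\<bar> \<le> C * B"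
    using green_function.green_op_bound[OF g] by (metis (no_types, lifting))
  define D where "D = \<bar>e\<bar> * (C * B)"
  have D: "D \<ge> 0"
    using B C by (simp add: D_def)
  have le: "e * S M l \<sigma> t \<le> \<epsilon> * D" if "\<epsilon> > 0" for \<epsilon>
  proof -
    obtain M' where M': "M' \<in> X e l" "M' \<in> X 1 0" "M < M'" "M' < M + \<epsilon>" "M' \<le> M2"
      using approx[OF \<open>\<epsilon> > 0\<close>] by blast
    note g' = green_function_X[OF M'(1)]
    have y: "continuous_on {a..b} (S M' 0 \<sigma>)"
      by (rule green_function.continuous_on_green_op[OF g' n_pos \<sigma>(1)])
    have yB: "\<bar>S M' 0 \<sigma> r\<bar> \<le> B" if "r \<in> {a..b}" for r
      using op_mono(1)[OF M'(2) M2(1) n_pos \<sigma> that M'(5)] X_op[OF M'(2) n_pos that \<sigma>] B(2)[OF that]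
      by simp
    have "\<bar>e * S M l (S M' 0 \<sigma>) t\<bar> \<le> D"
      unfolding D_def abs_mult using C(2)[OF less_imp_le[OF l] t y yB] by (intro mult_left_mono) auto
    then have "(M' - M) * (e * S M l (S M' 0 \<sigma>) t) \<le> (M' - M) * D"
      using M'(3) by (intro mult_left_mono) auto
    also have "\<dots> \<le> \<epsilon> * D"
      using M'(4) D by (intro mult_right_mono) auto
    finally have "(M' - M) * (e * S M l (S M' 0 \<sigma>) t) \<le> \<epsilon> * D" .
    moreover have "e * S M' l \<sigma> t = e * S M l \<sigma> t - (M' - M) * (e * S M l (S M' 0 \<sigma>) t)"
      using arg_cong[OF green_op_resolvent[OF g g' \<sigma>(1) l t], of "(*) e"]
      by (simp only: distrib_left left_diff_distrib right_diff_distrib mult.left_commute)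
    moreover have "e * S M' l \<sigma> t \<le> 0"
      using X_op[OF M'(1) l t \<sigma>] .
    ultimately show ?thesis
      by linarith
  qed
  show "e * S M l \<sigma> t \<le> 0"
  proof (rule field_le_epsilon)
    fix \<delta> :: real assume "\<delta> > 0"
    have "e * S M l \<sigma> t \<le> \<delta> / (D + 1) * D"
      using D \<open>\<delta> > 0\<close> by (intro le) auto
    also have "\<dots> \<le> 0 + \<delta>"
      using D \<open>\<delta> > 0\<close> by (simp add: field_simps)
    finally show "e * S M l \<sigma> t \<le> 0 + \<delta>" .
  qed
qed

text \<open>
  For \<open>\<sigma> \<ge> 0\<close> the positive part \<open>v\<close> of \<open>S M 0 \<sigma>\<close> satisfies \<open>v \<le> w\<close> with \<open>w = (M - M'') A v\<close> and
  \<open>A = - S M'' 0\<close>.  Testing with the kernel of order \<open>l\<close> at \<open>M\<close>, which dominates in absolute value the one at \<open>M''\<close>,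
  forces equality and \<open>S M'' l w = 0\<close>.  Hence \<open>w\<close> vanishes on an interval, and then so does \<open>v\<close>
  everywhere, because the kernel at \<open>M\<^sub>0\<close> vanishes on no rectangle.
\<close>

lemma X_above_imp_N0:
  assumes M0: "M\<^sub>0 \<in> X 1 0" and M'': "M'' \<in> X e l" "M'' \<in> X 1 0" and M: "M \<in> X e l"
    and "M\<^sub>0 \<le> M''" "M'' < M" and e: "e \<noteq> 0" and l: "l < n"
    and nonvanish: "\<And>x y u v. a \<le> x \<Longrightarrow> x < y \<Longrightarrow> y \<le> b \<Longrightarrow> a \<le> u \<Longrightarrow> u < v \<Longrightarrow> v \<le> b \<Longrightarrow>
      \<exists>t\<in>{x<..<y}. \<exists>s\<in>{u<..<v}. G M\<^sub>0 t s \<noteq> 0"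
  shows "M \<in> X 1 0"
proof (rule X_I)
  show "has_green a b n c \<alpha> \<beta> M" "0 < n"
    using M n2 by (auto simp: sgn_set_def)
  fix \<sigma> :: "real \<Rightarrow> real" and t assume \<sigma>: "continuous_on {a..b} \<sigma>" "\<And>r. r \<in> {a..b} \<Longrightarrow> 0 \<le> \<sigma> r" and "t \<in> {a..b}"
  note g0 = green_function_X[OF M0] and g'' = green_function_X[OF M''(1)] and g = green_function_X[OF M]
  define \<mu> where "\<mu> = M - M''"
  have \<mu>: "\<mu> > 0"
    using \<open>M'' < M\<close> by (simp add: \<mu>_def)
  define v where "v r = max (S M 0 \<sigma> r) 0" for r
  define w where "w r = (- \<mu>) * S M'' 0 v r" for r
  have x: "continuous_on {a..b} (S M 0 \<sigma>)"
    using green_function.continuous_on_green_op[OF g n_pos \<sigma>(1)] .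
  then have v: "continuous_on {a..b} v" and v0: "\<And>r. 0 \<le> v r"
    unfolding v_def by (auto intro!: continuous_intros)
  have Av: "continuous_on {a..b} (S M'' 0 v)"
    using green_function.continuous_on_green_op[OF g'' n_pos v] .
  then have w: "continuous_on {a..b} w"
    unfolding w_def by (intro continuous_intros)
  have w0: "0 \<le> w r" if "r \<in> {a..b}" for r
    using X_op[OF M''(2) n_pos that v v0] \<mu> by (simp add: w_def mult_nonneg_nonpos)
  \<comment> \<open>Write A for - \<open>S M'' 0\<close> and x for \<open>S M 0 \<sigma>\<close>.
    The resolvent identity gives x \<le> \<mu> A x, and x \<le> v turns this into x \<le> \<mu> A v
    = w; as w is nonnegative, the positive part of x is below w too.\<close>
  have vw: "v r \<le> w r" if r: "r \<in> {a..b}" for r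
  proof -
    let ?d = "\<lambda>r. 1 * v r + (- 1) * S M 0 \<sigma> r"
    have "continuous_on {a..b} ?d"
      by (intro continuous_intros v x)
    moreover have "0 \<le> ?d r" for r
      by (simp add: v_def)
    ultimately have "S M'' 0 ?d r \<le> 0"
      using X_op[OF M''(2) n_pos r] by fastforce
    then have "S M'' 0 v r \<le> S M'' 0 (S M 0 \<sigma>) r"
      using green_function.green_op_lincomb[OF g'' _ r v x, of 0 1 "- 1"] by simp
    then have "(- \<mu>) * S M'' 0 (S M 0 \<sigma>) r \<le> w r"
      using \<mu> by (simp add: w_def)
    moreover have "S M 0 \<sigma> r = S M'' 0 \<sigma> r + (- \<mu>) * S M'' 0 (S M 0 \<sigma>) r"
      using green_op_resolvent[OF g'' g \<sigma>(1) n_pos r] by (simp add: \<mu>_def)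
    moreover have "S M'' 0 \<sigma> r \<le> 0"
      using X_op[OF M''(2) n_pos r \<sigma>] by simp
    ultimately show ?thesis
      using w0[OF r] by (simp add: v_def)
  qed
  \<comment> \<open>Let F and E be - e times the operators of order \<open>l\<close> at M and M''.
    The resolvent identity based at M reads E v = F v - F w, that is, E v = - F (w - v). The left
    side is nonnegative and the right side nonpositive, so both vanish. Since 0 \<le> E (w - v)
    \<le> F (w - v) = 0, also E w = 0.\<close>
  have Sw0: "e * S M'' l w r = 0" if r: "r \<in> {a..b}" for r
  proof -
    let ?d = "\<lambda>r. 1 * w r + (- 1) * v r"
    have d: "continuous_on {a..b} ?d" "\<And>r. r \<in> {a..b} \<Longrightarrow> 0 \<le> ?d r"
      using v w vw by (auto intro!: continuous_intros)
    note ln = less_imp_le[OF l]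
    have "S M l w r = (- \<mu>) * S M l (S M'' 0 v) r"
      unfolding w_def using green_function.green_op_scale[OF g ln r Av] .
    then have Sv: "S M'' l v r = S M l v r - S M l w r"
      using green_op_resolvent[OF g g'' v l r] by (simp add: \<mu>_def left_diff_distrib)
    have Sd: "S M l ?d r = S M l w r - S M l v r" "S M'' l ?d r = S M'' l w r - S M'' l v r"
      using green_function.green_op_lincomb[OF g ln r w v, of 1 "- 1"]
        green_function.green_op_lincomb[OF g'' ln r w v, of 1 "- 1"] by auto
    have "e * S M'' l v r = - (e * S M l ?d r)"
      unfolding Sv Sd by (simp only: mult_minus_right[symmetric] minus_diff_eq)
    moreover have "e * S M'' l ?d r = e * S M'' l w r - e * S M'' l v r"
      unfolding Sd by (rule right_diff_distrib)
    moreover have "e * S M'' l v r \<le> 0" "e * S M l ?d r \<le> 0" "e * S M'' l ?d r \<le> 0"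
      "e * S M l ?d r \<le> e * S M'' l ?d r"
      using X_op[OF M''(1) l r v v0] X_op[OF M l r d] X_op[OF M''(1) l r d]
        op_mono(2)[OF M M''(2) l d r] \<open>M'' < M\<close> by auto
    ultimately show ?thesis
      by linarith
  qed
  obtain s0 t0 where s0: "s0 \<in> {a<..<b}" and t0: "t0 \<in> {a..b} - {s0}"
    and K0: "tderiv a b l (G M'') t0 s0 \<noteq> 0"
    using green_function.K_nontrivial[OF g'' l] by blast
  have neg: "e * tderiv a b l (G M'') t0 r \<le> 0" if "r \<in> {a<..<b} - {t0}" for r
    using M''(1) that t0 by (auto simp: sgn_set_def green_dom_def off_diag_def split: if_splits)
  have dom: "(t0, r) \<in> green_dom a b n l" if "r \<in> {a..b} - {t0}" for r
    using that t0 by (auto simp: green_dom_def off_diag_def)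
  have K0': "0 < - (e * tderiv a b l (G M'') t0 s0)"
    using neg[of s0] K0 e s0 t0 by (auto simp: less_le)
  have "continuous (at s0 within {a..b}) (\<lambda>r. - (e * tderiv a b l (G M'') t0 r))"
    using green_function.continuous_K_dom[OF g'' l dom[of s0]] s0 t0
    by (intro continuous_intros) auto
  from pos_near_within[OF this K0']
  obtain d where d: "d > 0"
    "\<And>r. r \<in> {a..b} \<Longrightarrow> \<bar>r - s0\<bar> < d \<Longrightarrow> - (e * tderiv a b l (G M'') t0 s0) / 2 < - (e * tderiv a b l (G M'') t0 r)"
    by blast
  \<comment> \<open>Shrinking \<open>d\<close> keeps the interval away from \<open>t0\<close>: for
    \<open>l = n - 1\<close> the sign of the kernel is known off the diagonal only.\<close>
  define d' where "d' = min d \<bar>t0 - s0\<bar>"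
  have d': "d' > 0"
    using d(1) t0 by (simp add: d'_def)
  obtain x y where xy: "x < y" "a \<le> x" "y \<le> b" "{x<..<y} \<subseteq> {s0 - d'<..<s0 + d'}"
    using subinterval_near[OF ab _ d', of s0] s0 by auto
  have wz: "w r = 0" if r: "r \<in> {x<..<y}" for r
  proof -
    have rd: "\<bar>r - s0\<bar> < d" "r \<noteq> t0" "r \<in> {a<..<b}"
      using subsetD[OF xy(4) r] xy r by (auto simp: d'_def abs_if split: if_splits)
    show ?thesis
    proof (rule green_function.green_op_eq_0D[OF g'' l _ w w0 neg Sw0])
      show "e * tderiv a b l (G M'') t0 r < 0"
        using d(2)[of r] rd K0' by auto
    qed (use t0 rd dom in auto)
  qed
  \<comment> \<open>The kernel at \<open>M\<^sub>0\<close> is dominated in absolute value by the one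
    at M'', so the zeros found at M'' are passed down to the parameter for which nonvanishing is
    known.\<close>
  have S0: "S M\<^sub>0 0 v r = 0" if r: "r \<in> {x<..<y}" for r
  proof -
    have rI: "r \<in> {a..b}"
      using r xy by auto
    have "S M'' 0 v r = 0"
      using wz[OF r] \<mu> by (simp add: w_def)
    then show ?thesis
      using op_mono(1)[OF M0 M''(2) n_pos v v0 rI \<open>M\<^sub>0 \<le> M''\<close>] X_op[OF M0 n_pos rI v v0] by simp
  qed
  have "v t = 0"
  proof (rule ccontr)
    assume "v t \<noteq> 0"
    then have "v t > 0"
      using v0[of t] by simp
    moreover have "continuous (at t within {a..b}) v"
      using v \<open>t \<in> {a..b}\<close> by (simp add: continuous_on_eq_continuous_within)
    ultimately obtain k where k: "k > 0" "\<And>r. r \<in> {a..b} \<Longrightarrow> \<bar>r - t\<bar> < k \<Longrightarrow> v t / 2 < v r"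
      using pos_near_within by blast
    obtain u z where uz: "u < z" "a \<le> u" "z \<le> b" "{u<..<z} \<subseteq> {t - k<..<t + k}"
      using subinterval_near[OF ab \<open>t \<in> {a..b}\<close> k(1)] by blast
    obtain q s where q: "q \<in> {x<..<y}" and s: "s \<in> {u<..<z}" and gs: "G M\<^sub>0 q s \<noteq> 0"
      using nonvanish[OF xy(2,1,3) uz(2,1,3)] by blast
    have dom0: "(q, r) \<in> green_dom a b n 0" if "r \<in> {a..b}" for r
      using that q xy n2 by (auto simp: green_dom_def)
    have neg0: "1 * tderiv a b 0 (G M\<^sub>0) q r \<le> 0" if "r \<in> {a..b}" for r
      using M0 dom0[OF that] by (auto simp: sgn_set_def)
    have sI: "s \<in> {a<..<b}" "q \<in> {a..b}"
      using s q uz xy by auto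
    have "v s = 0"
    proof (rule green_function.green_op_eq_0D[OF g0 n_pos sI(2) v v0 neg0])
      show "1 * S M\<^sub>0 0 v q = 0"
        using S0[OF q] by simp
      show "1 * tderiv a b 0 (G M\<^sub>0) q s < 0"
        using neg0[of s] gs sI by (simp add: tderiv_def less_le)
    qed (use dom0 sI in auto)
    moreover have "v t / 2 < v s"
      using subsetD[OF uz(4) s] sI by (intro k) (auto simp: abs_if)
    ultimately show False
      using \<open>v t > 0\<close> by simp
  qed
  then show "1 * S M 0 \<sigma> t \<le> 0"
    by (simp add: v_def)
qed

end

section \<open>Consequences of condition (N_g)\<close>

lemma AE_lborel_snd:
  assumes "AE s in lborel. (P :: real \<Rightarrow> bool) s"
  shows "AE p in (lborel :: (real \<times> real) measure). P (snd p)"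
proof -
  obtain Z where Z: "{s. \<not> P s} \<subseteq> Z" "Z \<in> null_sets lborel"
    using AE_E[OF assms] by (auto simp: null_sets_def)
  have "UNIV \<times> Z \<in> null_sets (lborel \<Otimes>\<^sub>M lborel :: (real \<times> real) measure)"
    by (rule lborel.times_in_null_sets2[OF _ Z(2)]) simp
  then have "UNIV \<times> Z \<in> null_sets (lborel :: (real \<times> real) measure)"
    by (simp add: lborel_prod)
  from AE_not_in[OF this] show ?thesis
    by eventually_elim (use Z in auto)
qed

text \<open>An open rectangle is not negligible, so it contains a point where the almost everywhere
  bounds hold. There \<phi> is positive, the rectangle being open inside the square, and
  \<open>k2\<close> is negative.\<close>

lemma cond_Ng_neg:
  assumes "cond_Ng a b g" "x < y" "u < v" "a \<le> x" "y \<le> b" "a \<le> u" "v \<le> b"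
  shows "\<exists>t\<in>{x<..<y}. \<exists>s\<in>{u<..<v}. g t s < 0"
proof (rule ccontr)
  assume contra: "\<not> ?thesis"
  obtain \<phi> k1 k2 where \<phi>: "\<forall>t\<in>{a<..<b}. \<phi> t > 0"
    and k: "AE s in lebesgue_on {a..b}. k1 s < k2 s \<and> k2 s < (0 :: real)"
    and g: "AE (t, s) in lebesgue_on ({a..b} \<times> {a..b}). \<phi> t * k1 s \<le> g t s \<and> g t s \<le> \<phi> t * k2 s"
    using assms(1) by (auto simp: cond_Ng_def)
  have "AE s in lebesgue. s \<in> {a..b} \<longrightarrow> k2 s < 0"
    using k by (subst (asm) AE_restrict_space_iff) (auto elim: eventually_mono)
  then have "AE s in lborel. s \<in> {a..b} \<longrightarrow> k2 s < 0"
    by (simp add: AE_completion_iff)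
  then have "AE p in (lborel :: (real \<times> real) measure). snd p \<in> {a..b} \<longrightarrow> k2 (snd p) < 0"
    by (rule AE_lborel_snd)
  then have k2: "AE p in (lebesgue :: (real \<times> real) measure). snd p \<in> {a..b} \<longrightarrow> k2 (snd p) < 0"
    by (rule AE_completion)
  have "AE p in lebesgue. p \<in> {a..b} \<times> {a..b} \<longrightarrow> g (fst p) (snd p) \<le> \<phi> (fst p) * k2 (snd p)"
  proof -
    have "{a..b} \<times> {a..b} \<in> sets (lebesgue :: (real \<times> real) measure)"
      using lebesgue_closedin[of UNIV "{a..b} \<times> {a..b}"] by (simp add: closed_Times)
    then show ?thesis
      using g by (subst (asm) AE_restrict_space_iff) (auto elim!: eventually_mono simp: case_prod_beta)
  qed
  then have "AE p in (lebesgue :: (real \<times> real) measure). p \<notin> {x<..<y} \<times> {u<..<v}"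
    using k2
  proof eventually_elim
    case (elim p)
    show ?case
    proof
      assume p: "p \<in> {x<..<y} \<times> {u<..<v}"
      then have *: "fst p \<in> {x<..<y}" "snd p \<in> {u<..<v}"
        by auto
      have "g (fst p) (snd p) \<le> \<phi> (fst p) * k2 (snd p)"
        using elim(1) * assms by (auto simp: mem_Times_iff)
      moreover have "\<phi> (fst p) * k2 (snd p) < 0"
        using elim(2) \<phi> * assms by (intro mult_pos_neg) auto
      ultimately show False
        using contra * by force
    qed
  qed
  then have "negligible ({x<..<y} \<times> {u<..<v})"
    by (auto simp: eventually_ae_filter_negligible elim: negligible_subset)
  moreover have "open ({x<..<y} \<times> {u<..<v})"
    by (intro open_Times open_greaterThanLessThan)
  ultimately show False
    using open_not_negligible[of "{x<..<y} \<times> {u<..<v}"] assms(2,3) by auto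
qed

context bvp_family
begin

text \<open>Passes from almost everywhere to everywhere: since \<open>2 \<le> n\<close> the kernel
  is continuous on the square, so a positive value would persist on a small rectangle, yet every
  rectangle contains a negative value.\<close>

lemma cond_Ng_imp_N0:
  assumes M: "has_green a b n c \<alpha> \<beta> M" and Ng: "cond_Ng a b (G M)"
  shows "M \<in> X 1 0"
proof -
  interpret g: green_function a b n c \<alpha> \<beta> M "G M"
    using green_function_G[OF M] .
  have "G M t s \<le> 0" if ts: "t \<in> {a..b}" "s \<in> {a..b}" for t s
  proof (rule ccontr)
    assume "\<not> G M t s \<le> 0"
    then have pos: "G M t s > 0"
      by simp
    have "continuous (at (t, s) within {a..b} \<times> {a..b}) (\<lambda>p. G M (fst p) (snd p))"
      using g.continuous_on_K_square[of 0] ts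
      by (auto simp: continuous_on_eq_continuous_within tderiv_def case_prod_beta)
    then have "\<exists>d>0. \<forall>p\<in>{a..b} \<times> {a..b}. dist p (t, s) < d \<longrightarrow>
        dist (G M (fst p) (snd p)) (G M t s) < G M t s"
      using pos unfolding continuous_within_eps_delta fst_conv snd_conv by blast
    then obtain d where d: "d > 0"
      "\<And>p. p \<in> {a..b} \<times> {a..b} \<Longrightarrow> dist p (t, s) < d \<Longrightarrow>
        dist (G M (fst p) (snd p)) (G M t s) < G M t s"
      by blast
    obtain x y where xy: "x < y" "a \<le> x" "y \<le> b" "{x<..<y} \<subseteq> {t - d / 2<..<t + d / 2}"
      using subinterval_near[OF ab ts(1), of "d / 2"] d(1) by auto
    obtain u v where uv: "u < v" "a \<le> u" "v \<le> b" "{u<..<v} \<subseteq> {s - d / 2<..<s + d / 2}"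
      using subinterval_near[OF ab ts(2), of "d / 2"] d(1) by auto
    obtain t' s' where p: "t' \<in> {x<..<y}" "s' \<in> {u<..<v}" "G M t' s' < 0"
      using cond_Ng_neg[OF Ng xy(1) uv(1) xy(2,3) uv(2,3)] by blast
    have "dist (t', s') (t, s) \<le> \<bar>t' - t\<bar> + \<bar>s' - s\<bar>"
      unfolding dist_Pair_Pair by (rule order_trans[OF sqrt_sum_squares_le_sum_abs]) (simp add: dist_real_def)
    also have "\<dots> < d"
      using subsetD[OF xy(4) p(1)] subsetD[OF uv(4) p(2)] by (auto simp: abs_if)
    finally have "dist (G M t' s') (G M t s) < G M t s"
      using d(2)[of "(t', s')"] p xy uv by auto
    then show False
      using p(3) by (simp add: dist_real_def)
  qed
  then show ?thesis
    using M n2 by (auto simp: sgn_set_def green_dom_def tderiv_def)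
qed

section \<open>Suprema and monotonicity for both sign conditions\<close>

lemma sgn_set_main:
  assumes M0: "has_green a b n c \<alpha> \<beta> M\<^sub>0" and Ng: "cond_Ng a b (G M\<^sub>0)"
    and N0: "X 1 0 = (if bdd_below (X 1 0) then {m1..<m} else {..<m})"
    and l: "l < n" and e: "e \<noteq> 0" and M1: "M1 \<in> X e l" "M1 < m"
  shows "Sup (ereal ` X e l) = ereal m" "Sup (ereal ` X 1 0) = ereal m"
    and "(t, s) \<in> green_dom a b n l \<Longrightarrow>
      antimono_on (max_inf_interval (X 1 0) (X e l) m) (\<lambda>M. e * tderiv a b l (G M) t s)"
proof -
  have M0X: "M\<^sub>0 \<in> X 1 0"
    using cond_Ng_imp_N0[OF M0 Ng] .
  have X0_less: "M < m" if "M \<in> X 1 0" for M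
    using that N0 by (auto split: if_splits)
  have X0_up: "M' \<in> X 1 0" if "M \<in> X 1 0" "M \<le> M'" "M' < m" for M M'
    using that N0 by (auto split: if_splits)
  \<comment> \<open>A common point of both sets that lies above \<open>M\<^sub>0\<close>, as the
    maximum principle requires: below m, N_0 is closed upward, and within N_0 so is the set for
    \<open>l\<close>.\<close>
  define M2 where "M2 = max M\<^sub>0 M1"
  have M2: "M2 \<in> X 1 0" "M2 \<in> X e l" "M\<^sub>0 \<le> M2"
  proof -
    show "M\<^sub>0 \<le> M2"
      by (simp add: M2_def)
    show *: "M2 \<in> X 1 0"
      using X0_up[OF M0X, of M2] X0_less[OF M0X] M1(2) by (simp add: M2_def)
    show "M2 \<in> X e l"
      using X_upward[OF M1(1) * _ l] by (simp add: M2_def)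
  qed
  \<comment> \<open>A parameter at or above m in the set for \<open>l\<close> would be forced into
    N_0 by the maximum principle, but N_0 ends at m.\<close>
  have Xel_less: "M < m" if M: "M \<in> X e l" for M
  proof (rule ccontr)
    assume "\<not> M < m"
    then have "M2 < M"
      using X0_less[OF M2(1)] by simp
    have "M \<in> X 1 0"
    proof (rule X_above_imp_N0[OF M0X M2(2,1) M M2(3) \<open>M2 < M\<close> e l])
      fix x y u v :: real assume "a \<le> x" "x < y" "y \<le> b" "a \<le> u" "u < v" "v \<le> b"
      then show "\<exists>t\<in>{x<..<y}. \<exists>s\<in>{u<..<v}. G M\<^sub>0 t s \<noteq> 0"
        using cond_Ng_neg[OF Ng, of x y u v] by force
    qed
    then show False
      using X0_less \<open>\<not> M < m\<close> by blast
  qed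
  have Sup: "Sup (ereal ` Y) = ereal m"
    if le: "\<And>M. M \<in> Y \<Longrightarrow> M < m" and ge: "\<And>M. M2 \<le> M \<Longrightarrow> M < m \<Longrightarrow> M \<in> Y" for Y
  proof (rule antisym)
    show "Sup (ereal ` Y) \<le> ereal m"
      using le by (intro Sup_least) (auto simp: less_imp_le)
    show "ereal m \<le> Sup (ereal ` Y)"
    proof (rule dense_le_bounded[of "ereal M2"])
      show "ereal M2 < ereal m"
        using X0_less[OF M2(1)] by simp
      fix w assume w: "ereal M2 < w" "w < ereal m"
      then obtain r where "w = ereal r"
        by (cases w) auto
      then show "w \<le> Sup (ereal ` Y)"
        using w ge[of r] by (auto intro!: Sup_upper)
    qed
  qed
  show "Sup (ereal ` X 1 0) = ereal m"
    by (rule Sup) (use X0_less X0_up[OF M2(1)] in auto)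
  show "Sup (ereal ` X e l) = ereal m"
    by (rule Sup) (use Xel_less X_upward[OF M2(2) X0_up[OF M2(1)] _ l] in auto)
  have inX: "M \<in> X 1 0 \<and> M \<in> X e l" if M: "M \<in> max_inf_interval (X 1 0) (X e l) m" for M
  proof
    have Mm: "M < m" and I0: "Inf (ereal ` X 1 0) \<le> ereal M" and Il: "Inf (ereal ` X e l) \<le> ereal M"
      using M by (auto simp: max_inf_interval_def)
    \<comment> \<open>If N_0 is bounded below, its left end belongs to it by \<open>N0\<close>, so
      lying at or above the infimum suffices.\<close>
    show MX: "M \<in> X 1 0"
    proof (cases "bdd_below (X 1 0)")
      case True
      then have X0: "X 1 0 = {m1..<m}"
        using N0 by simp
      have "ereal m1 \<le> Inf (ereal ` X 1 0)"
        unfolding X0 by (auto intro!: Inf_greatest)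
      then have "ereal m1 \<le> ereal M"
        using I0 by (rule order_trans)
      then show ?thesis
        using Mm by (simp add: X0)
    next
      case False
      then show ?thesis
        using N0 Mm by auto
    qed
    \<comment> \<open>Either some member of the set lies at or below M, or M is the infimum itself
      and is approached strictly from above.\<close>
    show "M \<in> X e l"
    proof (cases "\<exists>M'\<in>X e l. M' \<le> M")
      case True
      then show ?thesis
        using X_upward[OF _ MX _ l] by blast
    next
      case False
      \<comment> \<open>Any parameter strictly between M and m would do; it lies in N_0 and supplies
        the uniform bound for the approximating parameters below it.\<close>
      define M3 where "M3 = (M + m) / 2"
      have M3: "M < M3" "M3 < m"
        using Mm by (auto simp: M3_def)
      show ?thesis
      proof (rule X_closed_below[OF MX X0_up[OF MX less_imp_le[OF M3(1)] M3(2)] M3(1) l])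
        fix \<epsilon> :: real assume "\<epsilon> > 0"
        then have "ereal M < ereal (min (M + \<epsilon>) M3)"
          using M3 by simp
        then have "Inf (ereal ` X e l) < ereal (min (M + \<epsilon>) M3)"
          using Il by (rule le_less_trans[rotated])
        then obtain M' where M': "M' \<in> X e l" "M' < min (M + \<epsilon>) M3"
          unfolding Inf_less_iff by auto
        then have "M < M'"
          using False by force
        then show "\<exists>M'\<in>X e l. M' \<in> X 1 0 \<and> M < M' \<and> M' < M + \<epsilon> \<and> M' \<le> M3"
          using M' X0_up[OF MX, of M'] M3 by auto
      qed
    qed
  qed
  show "antimono_on (max_inf_interval (X 1 0) (X e l) m) (\<lambda>M. e * tderiv a b l (G M) t s)"
    if "(t, s) \<in> green_dom a b n l"
    using kernel_mono[OF _ _ _ l that] inX by (intro monotone_onI) blast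
qed

end

theorem theorem3p7:
  fixes a b Mbar M0bar M1bar :: real
    and n :: nat
    and c :: "nat \<Rightarrow> real \<Rightarrow> real"
    and \<alpha> \<beta> :: "nat \<Rightarrow> nat \<Rightarrow> real"
  defines "G \<equiv> green a b n c \<alpha> \<beta>"
    and "N \<equiv> N_set a b n c \<alpha> \<beta>"
    and "P \<equiv> P_set a b n c \<alpha> \<beta>"
  assumes ab: "a < b"
    and coeffs: "\<And>k. k \<in> {1..n} \<Longrightarrow> continuous_on {a..b} (c k)"
    and green_ex: "has_green a b n c \<alpha> \<beta> Mbar"
    and Ng: "cond_Ng a b (G Mbar)"
    and N0: "N 0 = (if bdd_below (N 0) then {M1bar..<M0bar} else {..<M0bar})"
  shows
    "(\<forall>l\<in>{1..n - 1}. N l \<noteq> {} \<and> (\<exists>M1\<in>N l. M1 < M0bar) \<longrightarrow>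
        Sup (ereal ` N l) = Sup (ereal ` N 0) \<and> Sup (ereal ` N 0) = ereal M0bar \<and>
        (\<forall>(t, s)\<in>green_dom a b n l.
           antimono_on (max_inf_interval (N 0) (N l) M0bar) (\<lambda>M. tderiv a b l (G M) t s))) \<and>
     (\<forall>l\<in>{1..n - 1}. P l \<noteq> {} \<and> (\<exists>M1\<in>P l. M1 < M0bar) \<longrightarrow>
        Sup (ereal ` P l) = Sup (ereal ` N 0) \<and> Sup (ereal ` N 0) = ereal M0bar \<and>
        (\<forall>(t, s)\<in>green_dom a b n l.
           mono_on (max_inf_interval (N 0) (P l) M0bar) (\<lambda>M. tderiv a b l (G M) t s)))"
proof (intro conjI ballI impI)
  have N: "N = sgn_set a b n c \<alpha> \<beta> 1" and P: "P = sgn_set a b n c \<alpha> \<beta> (- 1)"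
    by (auto simp: N_def P_def N_set_eq_sgn_set P_set_eq_sgn_set)
  fix l assume l: "l \<in> {1..n - 1}"
  \<comment> \<open>The requirement \<open>2 \<le> n\<close> of the locale comes from the existence
    of an \<open>l\<close> between 1 and n - 1.\<close>
  then interpret bvp_family a b n c \<alpha> \<beta>
    by unfold_locales (use ab coeffs in auto)
  have ln: "l < n"
    using l by auto
  note main = sgn_set_main[OF green_ex Ng[unfolded G_def] N0[unfolded N] ln]
  {
    assume "N l \<noteq> {} \<and> (\<exists>M1\<in>N l. M1 < M0bar)"
    then obtain M1 where M1: "M1 \<in> sgn_set a b n c \<alpha> \<beta> 1 l" "M1 < M0bar"
      by (auto simp: N)
    note main1 = main[OF _ M1]
    show "Sup (ereal ` N l) = Sup (ereal ` N 0)" "Sup (ereal ` N 0) = ereal M0bar"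
      using main1(1,2) by (simp_all add: N)
    show "case x of (t, s) \<Rightarrow>
        antimono_on (max_inf_interval (N 0) (N l) M0bar) (\<lambda>M. tderiv a b l (G M) t s)"
      if "x \<in> green_dom a b n l" for x
      using main1(3) that by (auto simp: N G_def)
  }
  {
    assume "P l \<noteq> {} \<and> (\<exists>M1\<in>P l. M1 < M0bar)"
    then obtain M1 where M1: "M1 \<in> sgn_set a b n c \<alpha> \<beta> (- 1) l" "M1 < M0bar"
      by (auto simp: P)
    note main1 = main[OF _ M1]
    show "Sup (ereal ` P l) = Sup (ereal ` N 0)" "Sup (ereal ` N 0) = ereal M0bar"
      using main1(1,2) by (simp_all add: N P)
    show "case x of (t, s) \<Rightarrow>
        mono_on (max_inf_interval (N 0) (P l) M0bar) (\<lambda>M. tderiv a b l (G M) t s)"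
      if "x \<in> green_dom a b n l" for x
      using main1(3) that by (auto simp: N P G_def monotone_on_def)
  }
qed

end
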